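(* Let $n\ge3$ and let $\Theta:B_n\to\mathrm{Aut}(F_n)$ be a local $\mathrm{Aut}(F_n)$ representation of type $\mathcal{L}$, where $\mathcal{L}$ is one of $A_r$ with $r\ge1$, $C$, or $D$ (i.e. $\Theta$ is not of type $T$, $T'$, $A_0$, $B$). Then $\Theta$ is faithful.
   Context: $F_2$ is free on $a,b$; $F_n$ is free on $x_1,\dots,x_n$; $B_n$ has standard generators $\sigma_1,\dots,\sigma_{n-1}$ and acts on the right. For a word $W$ in $a^{\pm1},b^{\pm1}$, $W(U,V)$ denotes substitution of $U$ for $a$, $V$ for $b$. For $\tau\in\mathrm{Aut}(F_2)$ and $1\le i\le n-1$, $T^i(\tau)\in\mathrm{Aut}(F_n)$ fixes $x_j$ for $j\ne i,i+1$ and sends $x_i\mapsto \tau(a)(x_i,x_{i+1})$, $x_{i+1}\mapsto\tau(b)(x_i,x_{i+1})$. A local $\mathrm{Aut}(F_n)$ representation is a homomorphism $\Theta:B_n\to\mathrm{Aut}(F_n)$ such that $\Theta(\sigma_i)=T^i(\tau_i)$ for some $\tau_i\in\mathrm{Aut}(F_2)$ ($i=1,\dots,n-1$); we say $\Theta$ is defined by $(\tau_1,\dots,\tau_{n-1})$. Natural symmetries act on quadruples $(A,B,C,D)$ of reduced words with $\tau:a\mapsto A,b\mapsto B$, $\kappa:a\mapsto C,b\mapsto D$ automorphisms: Inverse replaces it by the reduced words of $\tau^{-1}(a),\tau^{-1}(b),\kappa^{-1}(a),\kappa^{-1}(b)$; Swap replaces it by $(D^{\sigma},C^{\sigma},B^{\sigma},A^{\sigma})$,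 $W^{\sigma}$ being $W$ with letters $a,b$ interchanged; Backward replaces it by the words read backwards $(\overleftarrow{A},\overleftarrow{B},\overleftarrow{C},\overleftarrow{D})$. Two quadruples are equivalent up to natural symmetries if related by a composition of these. Labelled list: ($A_r$-1) $(a^{r}ba^{-r},a,a^{r}ba^{-r},a)$; ($A_r$-2) $(a^{r}ba^{-r},a,a^{r}b^{-1}a^{-r},a^{-1})$; ($A_r$-3) $(a^{r}b^{-1}a^{-r},a^{-1},a^{-r}b^{-1}a^{r},a^{-1})$ ($r\in\mathbb{Z}_{\ge0}$); ($C$-1) $(ab^{-1}a,a,ab^{-1}a,a)$; ($C$-2) $(ab^{-1}a,a,aba,a^{-1})$; ($C$-3) $(aba,a^{-1},aba,a^{-1})$; ($D$-1) $(a^{-1}b^{-1}a,b^{2}a,a^{-1}b^{-1}a,b^{2}a)$; ($D$-2) $(aba^{-1},b^{2}a^{-1},a^{-1}b^{-1}a,b^{2}a)$; ($D$-3) $(a^{-1}b^{-1}a,b^{2}a,a^{-1}ba,a^{-1}b^{2})$; ($D$-4) $(aba^{-1},b^{2}a^{-1},a^{-1}ba,a^{-1}b^{2})$. The entries ($A_r$-1,2,3) with a fixed $r$ are labelled $A_r$, ($C$-1,2,3) labelled $C$, ($D$-1,…,4) labelled $D$. A local $\mathrm{Aut}(F_n)$ representation defined by $(\tau_1,\dots,\tau_{n-1})$ is of type $\mathcal{L}$ if for every $i=1,\dots,n-2$ the quadruple of reduced words $(\tau_i(a),\tau_i(b),\tau_{i+1}(a),\tau_{i+1}(b))$ is equivalent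 up to natural symmetries to an entry labelled $\mathcal{L}$. *)

theory Defs
  imports Main
begin

text \<open>A letter (k, True) is the generator x_k, (k, False) its inverse.
  F_n has generators indexed 1..n; F_2 has a = index 1, b = index 2.\<close>

type_synonym letter = "nat \<times> bool"
type_synonym word = "letter list"

definition cancels :: "letter \<Rightarrow> letter \<Rightarrow> bool" where
  "cancels x y \<longleftrightarrow> fst x = fst y \<and> snd x \<noteq> snd y"

fun red :: "word \<Rightarrow> word" where
  "red [] = []"
| "red (x # xs) = (case red xs of [] \<Rightarrow> [x]
                   | y # ys \<Rightarrow> if cancels x y then ys else x # y # ys)"

definition reduced :: "word \<Rightarrow> bool" where
  "reduced w \<longleftrightarrow> (\<forall>i. Suc i < length w \<longrightarrow> \<not> cancels (w ! i) (w ! Suc i))"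

definition inv_word :: "word \<Rightarrow> word" where
  "inv_word w = rev (map (\<lambda>(k, e). (k, \<not> e)) w)"

definition wsubst :: "(nat \<Rightarrow> word) \<Rightarrow> word \<Rightarrow> word" where
  "wsubst f w = red (concat (map (\<lambda>(k, e). if e then f k else inv_word (f k)) w))"

definition Fn :: "nat \<Rightarrow> word set" where
  "Fn n = {w. reduced w \<and> fst ` set w \<subseteq> {1..n}}"

definition is_aut :: "nat \<Rightarrow> (nat \<Rightarrow> word) \<Rightarrow> bool" where
  "is_aut n \<phi> \<longleftrightarrow> (\<forall>i\<in>{1..n}. fst ` set (\<phi> i) \<subseteq> {1..n}) \<and>
     (\<exists>\<psi>. \<forall>i\<in>{1..n}. fst ` set (\<psi> i) \<subseteq> {1..n} \<and>
        wsubst \<psi> (\<phi> i) = [(i, True)] \<and> wsubst \<phi> (\<psi> i) = [(i, True)])"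

definition pair2 :: "word \<Rightarrow> word \<Rightarrow> nat \<Rightarrow> word" where
  "pair2 U V = (\<lambda>k. if k = 1 then U else V)"

definition aut2 :: "word \<times> word \<Rightarrow> bool" where
  "aut2 t \<longleftrightarrow> is_aut 2 (pair2 (fst t) (snd t))"

definition Tmap :: "nat \<Rightarrow> word \<times> word \<Rightarrow> nat \<Rightarrow> word" where
  "Tmap i t = (\<lambda>j. if j = i then wsubst (pair2 [(i, True)] [(Suc i, True)]) (fst t)
                   else if j = Suc i then wsubst (pair2 [(i, True)] [(Suc i, True)]) (snd t)
                   else [(j, True)])"

text \<open>Braid words: letter (i, True) = sigma_i, (i, False) = sigma_i^{-1}, 1 \<le> i \<le> n-1.\<close>
definition BW :: "nat \<Rightarrow> word set" where
  "BW n = {w. fst ` set w \<subseteq> {1..n-1}}"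

inductive braid_eq :: "nat \<Rightarrow> word \<Rightarrow> word \<Rightarrow> bool" for n where
  refl: "braid_eq n u u"
| sym: "braid_eq n u v \<Longrightarrow> braid_eq n v u"
| trans: "braid_eq n u v \<Longrightarrow> braid_eq n v w \<Longrightarrow> braid_eq n u w"
| ctx: "braid_eq n u v \<Longrightarrow> braid_eq n (p @ u @ s) (p @ v @ s)"
| cancel: "1 \<le> i \<Longrightarrow> i \<le> n - 1 \<Longrightarrow> braid_eq n [(i, e), (i, \<not> e)] []"
| comm: "1 \<le> i \<Longrightarrow> i + 2 \<le> j \<Longrightarrow> j \<le> n - 1 \<Longrightarrow>
           braid_eq n [(i, True), (j, True)] [(j, True), (i, True)]"
| braid: "1 \<le> i \<Longrightarrow> i + 1 \<le> n - 1 \<Longrightarrow>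
           braid_eq n [(i, True), (Suc i, True), (i, True)] [(Suc i, True), (i, True), (Suc i, True)]"

text \<open>Right action: x . Theta(sigma_i) is the image of x under T^i(tau_i);
  x . Theta(sigma_i^{-1}) is its (unique) preimage in F_n.\<close>
definition act_letter :: "(nat \<Rightarrow> word \<times> word) \<Rightarrow> nat \<Rightarrow> letter \<Rightarrow> word \<Rightarrow> word" where
  "act_letter \<tau> n l x = (if snd l then wsubst (Tmap (fst l) (\<tau> (fst l))) x
      else (THE y. y \<in> Fn n \<and> wsubst (Tmap (fst l) (\<tau> (fst l))) y = x))"

definition act :: "(nat \<Rightarrow> word \<times> word) \<Rightarrow> nat \<Rightarrow> word \<Rightarrow> word \<Rightarrow> word" where
  "act \<tau> n w x = fold (act_letter \<tau> n) w x"

text \<open>(tau_1,...,tau_{n-1}) defines a local Aut(F_n) representation: each tau_i is in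
  Aut(F_2) and sigma_i \<mapsto> T^i(tau_i) extends to a homomorphism on B_n.\<close>
definition local_rep :: "nat \<Rightarrow> (nat \<Rightarrow> word \<times> word) \<Rightarrow> bool" where
  "local_rep n \<tau> \<longleftrightarrow> (\<forall>i\<in>{1..n-1}. aut2 (\<tau> i)) \<and>
     (\<forall>u\<in>BW n. \<forall>v\<in>BW n. braid_eq n u v \<longrightarrow> (\<forall>x\<in>Fn n. act \<tau> n u x = act \<tau> n v x))"

definition faithful :: "nat \<Rightarrow> (nat \<Rightarrow> word \<times> word) \<Rightarrow> bool" where
  "faithful n \<tau> \<longleftrightarrow> (\<forall>w\<in>BW n. (\<forall>x\<in>Fn n. act \<tau> n w x = x) \<longrightarrow> braid_eq n w [])"

type_synonym quad = "word \<times> word \<times> word \<times> word"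

definition swapw :: "word \<Rightarrow> word" where
  "swapw w = map (\<lambda>(k, e). (if k = 1 then 2 else if k = 2 then 1 else k, e)) w"

definition inv2 :: "word \<times> word \<Rightarrow> word \<times> word \<Rightarrow> bool" where
  "inv2 t t' \<longleftrightarrow> fst t' \<in> Fn 2 \<and> snd t' \<in> Fn 2 \<and>
     wsubst (pair2 (fst t) (snd t)) (fst t') = [(1, True)] \<and>
     wsubst (pair2 (fst t) (snd t)) (snd t') = [(2, True)] \<and>
     wsubst (pair2 (fst t') (snd t')) (fst t) = [(1, True)] \<and>
     wsubst (pair2 (fst t') (snd t')) (snd t) = [(2, True)]"

definition quad_step :: "quad \<Rightarrow> quad \<Rightarrow> bool" where
  "quad_step q q' \<longleftrightarrow> (case q of (A, B, C, D) \<Rightarrow> case q' of (A', B', C', D') \<Rightarrow>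
       (inv2 (A, B) (A', B') \<and> inv2 (C, D) (C', D'))
     \<or> q' = (swapw D, swapw C, swapw B, swapw A)
     \<or> q' = (rev A, rev B, rev C, rev D))"

definition quad_equiv :: "quad \<Rightarrow> quad \<Rightarrow> bool" where
  "quad_equiv = equivclp quad_step"

abbreviation ga :: letter where "ga \<equiv> (1, True)"
abbreviation gA :: letter where "gA \<equiv> (1, False)"
abbreviation gb :: letter where "gb \<equiv> (2, True)"
abbreviation gB :: letter where "gB \<equiv> (2, False)"

definition entries_A :: "nat \<Rightarrow> quad set" where
  "entries_A r = {
     (replicate r ga @ [gb] @ replicate r gA, [ga], replicate r ga @ [gb] @ replicate r gA, [ga]),
     (replicate r ga @ [gb] @ replicate r gA, [ga], replicate r ga @ [gB] @ replicate r gA, [gA]),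
     (replicate r ga @ [gB] @ replicate r gA, [gA], replicate r gA @ [gB] @ replicate r ga, [gA])}"

definition entries_C :: "quad set" where
  "entries_C = {
     ([ga, gB, ga], [ga], [ga, gB, ga], [ga]),
     ([ga, gB, ga], [ga], [ga, gb, ga], [gA]),
     ([ga, gb, ga], [gA], [ga, gb, ga], [gA])}"

definition entries_D :: "quad set" where
  "entries_D = {
     ([gA, gB, ga], [gb, gb, ga], [gA, gB, ga], [gb, gb, ga]),
     ([ga, gb, gA], [gb, gb, gA], [gA, gB, ga], [gb, gb, ga]),
     ([gA, gB, ga], [gb, gb, ga], [gA, gb, ga], [gA, gb, gb]),
     ([ga, gb, gA], [gb, gb, gA], [gA, gb, ga], [gA, gb, gb])}"

definition quad_of :: "(nat \<Rightarrow> word \<times> word) \<Rightarrow> nat \<Rightarrow> quad" where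
  "quad_of \<tau> i = (red (fst (\<tau> i)), red (snd (\<tau> i)), red (fst (\<tau> (Suc i))), red (snd (\<tau> (Suc i))))"

definition of_type :: "nat \<Rightarrow> (nat \<Rightarrow> word \<times> word) \<Rightarrow> quad set \<Rightarrow> bool" where
  "of_type n \<tau> L \<longleftrightarrow> (\<forall>i\<in>{1..n-2}. \<exists>e\<in>L. quad_equiv (quad_of \<tau> i) e)"

end

theory Submission
  imports Defs
begin

text \<open>Killing squares turns every representation of the list into the action of the braid group on
  the free product W of n groups of order two; for \<open>A_r\<close> with r > 1 this requires the generators
  of \<open>F_n\<close> to be sent to r-th roots of the generators of W, found among the permutations of
  \<open>W \<times> {0..<r}\<close>. The signs distinguishing the entries disappear, and the natural symmetries at most
  exchange the action of \<open>\<sigma>\<^sub>i\<close> with that of \<open>\<sigma>\<^sub>i\<^sup>-\<^sup>1\<close> simultaneously for all i. So it suffices that the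
  Hurwitz action on the factorization \<open>w\<^sub>1 \<dots> w\<^sub>n\<close> in W has trivial stabilizer.
  A reflection of W flips an edge of the Cayley tree, and conjugating one reflection by its
  neighbour shortens it iff the edge of the neighbour separates it from the identity vertex. Each
  Hurwitz move therefore strictly increases or decreases the total length, and every peak can be
  bypassed below its height by a braid relation, so that a closed path at the minimal factorization
  is a trivial braid. The only peak without such a bypass, both neighbours lying behind the
  middle edge, would violate the planar order of the partial products.\<close>

section \<open>The free product of groups of order two\<close>

text \<open>Left multiplication by the generator \<open>k\<close> on reduced words. Each
  \<open>push k\<close> is an involution there (\<open>push_push\<close>), so words act on reduced
  words, and associativity of the product follows from this action: van der Waerden's trick.\<close>

definition push :: "nat \<Rightarrow> nat list \<Rightarrow> nat list" where
  "push k l = (case l of [] \<Rightarrow> [k] | y # ys \<Rightarrow> if y = k then ys else k # l)"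

lemma distinct_adj_push: "distinct_adj l \<Longrightarrow> distinct_adj (push k l)"
  by (auto simp: push_def split: list.splits dest: distinct_adj_ConsD)

lemma push_push: "distinct_adj l \<Longrightarrow> push k (push k l) = l"
  by (auto simp: push_def split: list.splits)

lemma distinct_adj_foldr_push: "distinct_adj v \<Longrightarrow> distinct_adj (foldr push u v)"
  by (induction u) (auto intro: distinct_adj_push)

lemma push_eq_Cons: "distinct_adj (k # l) \<Longrightarrow> push k l = k # l"
  by (auto simp: push_def split: list.splits)

lemma foldr_push_reduced: "distinct_adj (u @ v) \<Longrightarrow> foldr push u v = u @ v"
proof (induction u)
  case (Cons k u)
  then have "foldr push u v = u @ v" by (auto dest: distinct_adj_ConsD)
  with Cons.prems show ?case by (simp add: push_eq_Cons)
qed simp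

lemma foldr_push_push:
  "distinct_adj v \<Longrightarrow> foldr push (push k u) v = push k (foldr push u v)"
  by (cases u) (auto simp: push_def[of k "_ # _"] push_push distinct_adj_foldr_push push_def[of k "[]"])

lemma foldr_push_foldr:
  "distinct_adj w \<Longrightarrow> foldr push (foldr push u v) w = foldr push u (foldr push v w)"
  by (induction u) (auto simp: foldr_push_push)

lemma foldr_push_rev: "distinct_adj u \<Longrightarrow> foldr push (rev u) u = []"
  by (induction u) (auto simp: push_def dest: distinct_adj_ConsD)

lemma length_foldr_push: "length (foldr push u v) \<le> length u + length v"
proof (induction u)
  case (Cons k u)
  have "length (push k l) \<le> Suc (length l)" for l
    by (auto simp: push_def split: list.splits)
  from this[of "foldr push u v"] Cons show ?case by simp
qed simp

text \<open>Countably many generators of order two, so that one type serves every n. The group is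
  written additively, though not commutative, to fit \<open>group_add\<close>.\<close>

typedef cox = "{l :: nat list. distinct_adj l}"
  morphisms letters Cox by (rule exI[of _ "[]"]) simp

setup_lifting type_definition_cox

instantiation cox :: group_add
begin
lift_definition zero_cox :: cox is "[]" by simp
lift_definition plus_cox :: "cox \<Rightarrow> cox \<Rightarrow> cox" is "foldr push"
  by (rule distinct_adj_foldr_push)
lift_definition uminus_cox :: "cox \<Rightarrow> cox" is rev by simp
definition minus_cox :: "cox \<Rightarrow> cox \<Rightarrow> cox" where "minus_cox a b = a + - b"
instance
  by standard
    (transfer; auto simp: foldr_push_foldr foldr_push_reduced foldr_push_rev minus_cox_def)+
end

section \<open>Permutation groups\<close>

typedef 'a perm_grp = "{f :: 'a \<Rightarrow> 'a. bij f}"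
  morphisms papp Perm by (rule exI[of _ id]) simp

setup_lifting type_definition_perm_grp

instantiation perm_grp :: (type) group_add
begin
lift_definition zero_perm_grp :: "'a perm_grp" is id by simp
lift_definition plus_perm_grp :: "'a perm_grp \<Rightarrow> 'a perm_grp \<Rightarrow> 'a perm_grp" is comp
  by (simp add: bij_comp)
lift_definition uminus_perm_grp :: "'a perm_grp \<Rightarrow> 'a perm_grp" is inv
  by (rule bij_imp_bij_inv)
definition minus_perm_grp :: "'a perm_grp \<Rightarrow> 'a perm_grp \<Rightarrow> 'a perm_grp" where
  "minus_perm_grp a b = a + - b"
instance
  by standard (transfer; auto simp: comp_assoc bij_is_inj minus_perm_grp_def)+
end

section \<open>Generators, words and lengths in W\<close>

lift_definition gen :: "nat \<Rightarrow> cox" is "\<lambda>k. [k]" by simp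

definition wd :: "nat list \<Rightarrow> cox" where "wd u = sum_list (map gen u)"

lemma wd_simps [simp]: "wd [] = 0" "wd (k # u) = gen k + wd u" "wd (u @ v) = wd u + wd v"
  by (simp_all add: wd_def)

lemma letters_wd_foldr: "letters (wd u) = foldr push u []"
  by (induction u) (simp_all add: zero_cox.rep_eq plus_cox.rep_eq gen.rep_eq)

lemma letters_wd: "distinct_adj u \<Longrightarrow> letters (wd u) = u"
  using foldr_push_reduced[of u "[]"] by (simp add: letters_wd_foldr)

lemma distinct_adj_letters [simp]: "distinct_adj (letters t)"
  using letters[of t] by simp

lemma wd_letters [simp]: "wd (letters t) = t"
  by (simp add: letters_inject[symmetric] letters_wd)

lemma letters_eqD: "letters t = u \<Longrightarrow> t = wd u"
  by auto

lemma gen_gen [simp]: "gen k + gen k = 0" "gen k + (gen k + x) = x" "- gen k = gen k"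
proof -
  show *: "gen k + gen k = 0" by transfer (simp add: push_def)
  show "gen k + (gen k + x) = x" by (metis * add.assoc add_0_left)
  show "- gen k = gen k" using * by (rule minus_unique)
qed

lemma uminus_wd: "- wd u = wd (rev u)"
  by (induction u) (simp_all add: minus_add)

lemma wd_rev [simp]: "wd (rev u) + wd u = 0" "wd u + wd (rev u) = 0"
  "wd (rev u) + (wd u + x) = x" "wd u + (wd (rev u) + x) = x"
  by (simp_all add: uminus_wd[symmetric])

definition len :: "cox \<Rightarrow> nat" where "len t = length (letters t)"

lemma len_wd: "len (wd u) \<le> length u"
  using length_foldr_push[of u "[]"] by (simp add: len_def letters_wd_foldr)

section \<open>Reflections\<close>

text \<open>These odd palindromes are the reduced words of the conjugates of generators;
  \<open>q\<close> and \<open>q @ [a]\<close> spell the ends of the flipped edge.\<close>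

definition reflection :: "cox \<Rightarrow> bool" where
  "reflection t \<longleftrightarrow> (\<exists>q a. letters t = q @ [a] @ rev q)"

lemma reflection_uminus: assumes "reflection t" shows "- t = t"
proof -
  obtain q a where "letters t = q @ [a] @ rev q" using assms by (auto simp: reflection_def)
  then have "t = wd (q @ [a] @ rev q)" by (rule letters_eqD)
  then show ?thesis by (simp add: uminus_wd del: wd_simps)
qed

lemma reflection_add_self: assumes "reflection t" shows "t + t = 0" "t + (t + x) = x"
  using reflection_uminus[OF assms] by (metis left_minus, metis minus_add_cancel)

lemma distinct_adj_Cons_rev: "distinct_adj (a # rev q) = distinct_adj (q @ [a])"
  using distinct_adj_rev[of "q @ [a]"] by simp

lemma reflection_wd: "distinct_adj (q @ [a]) \<Longrightarrow> reflection (wd (q @ [a] @ rev q))"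
proof -
  assume "distinct_adj (q @ [a])"
  then have "distinct_adj (q @ [a] @ rev q)"
    using distinct_adj_Cons_rev[of a q] by (auto simp: distinct_adj_append_iff)
  then show ?thesis unfolding reflection_def by (metis letters_wd)
qed

lemma reflection_gen: "reflection (gen k)"
  using reflection_wd[of "[]" k] by simp

lemma reflection_conj_gen: assumes "reflection t" shows "reflection (gen k + t + gen k)"
proof -
  obtain q a where qa: "letters t = q @ [a] @ rev q" using assms by (auto simp: reflection_def)
  have t: "t = wd (q @ [a] @ rev q)" using qa by (rule letters_eqD)
  have d: "distinct_adj (q @ [a])"
    using distinct_adj_letters[of t] unfolding qa by (auto simp: distinct_adj_append_iff)
  consider "q = []" "a = k" | q' where "q = k # q'" | "distinct_adj (k # q @ [a])"
    using d by (cases q) auto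
  then show ?thesis
  proof cases
    case 1
    then show ?thesis using t by (simp add: reflection_gen add.assoc)
  next
    case 2
    then have "gen k + t + gen k = wd (q' @ [a] @ rev q')" by (simp add: t add.assoc)
    moreover have "distinct_adj (q' @ [a])" using d 2 by (auto dest: distinct_adj_ConsD)
    ultimately show ?thesis using reflection_wd by metis
  next
    case 3
    have "gen k + t + gen k = wd ((k # q) @ [a] @ rev (k # q))" by (simp add: t add.assoc)
    then show ?thesis using reflection_wd[of "k # q" a] 3 by simp
  qed
qed

lemma reflection_conj_wd: "reflection t \<Longrightarrow> reflection (wd u + t + wd (rev u))"
proof (induction u)
  case (Cons k u)
  then show ?case using reflection_conj_gen[of "wd u + t + wd (rev u)" k] by (simp add: add.assoc)
qed simp

lemma reflection_conj: "reflection t \<Longrightarrow> reflection (g + t - g)"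
  using reflection_conj_wd[of t "letters g"]
  by (simp add: uminus_wd[symmetric])

text \<open>In the Cayley tree a reflection flips one edge; \<open>pre s t\<close> says that the edge of \<open>s\<close>
  separates the identity vertex from the edge of \<open>t\<close>.\<close>
definition pre :: "cox \<Rightarrow> cox \<Rightarrow> bool" where
  "pre s t \<longleftrightarrow> (\<exists>q a u. reflection u \<and> letters s = q @ [a] @ rev q
     \<and> letters t = q @ [a] @ letters u @ [a] @ rev q)"

lemma palindrome_inject:
  assumes "q @ [a] @ rev q = q' @ [a'] @ rev q'" shows "q = q' \<and> a = a'"
proof -
  have "length q = length q'" using arg_cong[OF assms, of length] by simp
  then show ?thesis using assms by simp
qed

lemma distinct_adj_middle:
  assumes "distinct_adj (q @ [a] @ rev q)" "distinct_adj (a # l @ [a])"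
  shows "distinct_adj (q @ [a] @ l @ [a] @ rev q)"
  using assms by (cases "l = []") (auto simp: distinct_adj_append_iff distinct_adj_Cons)

text \<open>The reflection \<open>s\<close> exchanges the two sides of its own edge. The edge of
  \<open>t\<close> is another one, so either it or its image under \<open>s\<close> lies beyond the
  edge of \<open>s\<close>. Which of the two is read off from whether the conjugate \<open>u\<close>
  of \<open>t\<close>, taken back by \<open>q\<close>, starts with the letter
  \<open>a\<close>.\<close>

lemma pre_dichotomy:
  assumes s: "reflection s" and t: "reflection t" and ne: "s \<noteq> t"
  shows "pre s t \<or> pre s (s + t + s)"
proof -
  obtain q a where ls: "letters s = q @ [a] @ rev q" using s by (auto simp: reflection_def)
  have s_eq: "s = wd q + gen a + wd (rev q)" using letters_eqD[OF ls] by (simp add: add.assoc)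
  have ds: "distinct_adj (q @ [a] @ rev q)" using distinct_adj_letters[of s] unfolding ls .
  define u where "u = wd (rev q) + t + wd q"
  have u: "reflection u" using reflection_conj_wd[OF t, of "rev q"] by (simp add: u_def)
  have t_eq: "t = wd q + u + wd (rev q)" by (simp add: u_def add.assoc)
  obtain r c where lu: "letters u = r @ [c] @ rev r" using u by (auto simp: reflection_def)
  have u_eq: "u = wd (r @ [c] @ rev r)" using letters_eqD[OF lu] .
  have du: "distinct_adj (r @ [c] @ rev r)" using distinct_adj_letters[of u] unfolding lu .
  consider "r = []" "c = a" | r' where "r = a # r'" | "hd (r @ [c]) \<noteq> a"
    by (cases r) auto
  then show ?thesis
  proof cases
    case 1
    then have "t = s" using t_eq s_eq u_eq by simp
    with ne show ?thesis by simp
  next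
    case 2
    define u' where "u' = wd (r' @ [c] @ rev r')"
    have d: "distinct_adj (r' @ [c])" "distinct_adj (r' @ [c] @ rev r')"
      using du 2 distinct_adj_Cons_rev[of c r']
      by (auto simp: distinct_adj_append_iff dest: distinct_adj_ConsD)
    have u': "reflection u'" unfolding u'_def by (rule reflection_wd[OF d(1)])
    have lu': "letters u' = r' @ [c] @ rev r'" unfolding u'_def by (rule letters_wd[OF d(2)])
    have "t = wd (q @ [a] @ letters u' @ [a] @ rev q)"
      unfolding t_eq u_eq lu' 2 by (simp add: add.assoc)
    moreover have "distinct_adj (a # letters u' @ [a])"
      using du unfolding lu' 2 by simp
    ultimately have "letters t = q @ [a] @ letters u' @ [a] @ rev q"
      using distinct_adj_middle[OF ds] letters_wd by metis
    then show ?thesis using ls u' unfolding pre_def by blast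
  next
    case 3
    have "s + t + s = wd (q @ [a] @ letters u @ [a] @ rev q)"
      unfolding t_eq s_eq by (simp add: add.assoc)
    moreover have "distinct_adj (a # letters u @ [a])"
    proof -
      have "hd (letters u) \<noteq> a" "last (letters u) \<noteq> a" "letters u \<noteq> []"
        using 3 unfolding lu by (cases r; simp)+
      then show ?thesis using distinct_adj_letters[of u]
        by (auto simp: distinct_adj_append_iff distinct_adj_Cons)
    qed
    ultimately have "letters (s + t + s) = q @ [a] @ letters u @ [a] @ rev q"
      using distinct_adj_middle[OF ds] letters_wd by metis
    then show ?thesis using ls u unfolding pre_def by blast
  qed
qed

text \<open>Stripping matching ends from a palindrome leaves a palindrome; as \<open>w\<close> is
  nonempty, the central letter survives in it.\<close>

lemma reflection_insideE:
  assumes "reflection t" "letters t = q @ [a] @ w @ [a] @ rev q" "length w > 0"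
  shows "reflection (wd w)" "letters (wd w) = w"
proof -
  have "distinct_adj (q @ [a] @ w @ [a] @ rev q)" using assms(2) distinct_adj_letters[of t] by simp
  then have "distinct_adj w" by (auto dest: distinct_adj_ConsD)
  then show l: "letters (wd w) = w" by (rule letters_wd)
  obtain p c where pc: "letters t = p @ [c] @ rev p" using assms(1) by (auto simp: reflection_def)
  have eq: "p @ [c] @ rev p = (q @ [a]) @ w @ rev (q @ [a])" using pc assms(2) by simp
  have "2 * length p = 2 * length q + length w + 1"
    using arg_cong[OF eq, of length] by simp
  with assms(3) have "length p \<ge> length (q @ [a])" by simp
  then have tk: "take (length (q @ [a])) p = q @ [a]"
    using arg_cong[OF eq, of "take (length (q @ [a]))"] by simp
  define p' where "p' = drop (length (q @ [a])) p"
  have p: "p = (q @ [a]) @ p'"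
    using append_take_drop_id[of "length (q @ [a])" p] unfolding tk p'_def by simp
  from eq have "w = p' @ [c] @ rev p'" unfolding p by simp
  then show "reflection (wd w)" using l by (auto simp: reflection_def)
qed

lemma pre_reflection: "pre s t \<Longrightarrow> reflection s" "pre s t \<Longrightarrow> reflection t"
proof -
  assume "pre s t"
  then obtain q a u where *: "reflection u" "letters s = q @ [a] @ rev q"
    "letters t = q @ [a] @ letters u @ [a] @ rev q" by (auto simp: pre_def)
  show "reflection s" using * by (auto simp: reflection_def)
  obtain r c where "letters u = r @ [c] @ rev r" using * by (auto simp: reflection_def)
  then have "letters t = (q @ [a] @ r) @ [c] @ rev (q @ [a] @ r)" using * by simp
  then show "reflection t" unfolding reflection_def by blast
qed

text \<open>Conjugation by \<open>s\<close> cancels both letters \<open>a\<close> that enclose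
  \<open>letters u\<close> in the word of \<open>t\<close>.\<close>

lemma len_pre:
  assumes "pre s t" shows "len s < len t" "len (s + (t + s)) < len t"
proof -
  obtain q a u where *: "reflection u" "letters s = q @ [a] @ rev q"
    "letters t = q @ [a] @ letters u @ [a] @ rev q" using assms by (auto simp: pre_def)
  show "len s < len t" using * by (simp add: len_def)
  have "s + (t + s) = wd (q @ letters u @ rev q)"
    using letters_eqD[OF *(2)] letters_eqD[OF *(3)] by (simp add: add.assoc)
  then have "len (s + (t + s)) \<le> length (q @ letters u @ rev q)" by (metis len_wd)
  then show "len (s + (t + s)) < len t" using * by (simp add: len_def)
qed

lemma not_pre_sym: "pre s t \<Longrightarrow> \<not> pre t s"
  using len_pre(1)[of s t] len_pre(1)[of t s] by auto

text \<open>Two nested layers: conjugating \<open>t\<close> by \<open>r + s\<close> removes both the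
  pair of letters \<open>a\<close> belonging to \<open>r\<close> and the pair \<open>c\<close>
  belonging to \<open>s\<close>. The length bound is needed for the detours around peaks.\<close>

lemma pre_chain:
  assumes "pre r s" "pre s t"
  shows "pre r t" "len (r + (s + (t + (s + r)))) < len t"
proof -
  obtain q a u where 1: "reflection u" "letters r = q @ [a] @ rev q"
    "letters s = q @ [a] @ letters u @ [a] @ rev q" using assms(1) by (auto simp: pre_def)
  obtain q' a' u' where 2: "reflection u'" "letters s = q' @ [a'] @ rev q'"
    "letters t = q' @ [a'] @ letters u' @ [a'] @ rev q'" using assms(2) by (auto simp: pre_def)
  obtain p c where pc: "letters u = p @ [c] @ rev p" using 1(1) by (auto simp: reflection_def)
  have "(q @ [a] @ p) @ [c] @ rev (q @ [a] @ p) = q' @ [a'] @ rev q'"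
    using 1(3) 2(2) pc by simp
  from palindrome_inject[OF this] have q': "q' = q @ [a] @ p" "a' = c" by auto
  have lt: "letters t = q @ [a] @ (p @ [c] @ letters u' @ [c] @ rev p) @ [a] @ rev q"
    using 2(3) unfolding q' by simp
  from reflection_insideE[OF pre_reflection(2)[OF assms(2)] this]
  show "pre r t" using 1(2) lt unfolding pre_def by fastforce
  have "r + (s + (t + (s + r))) = wd (q @ p @ letters u' @ rev p @ rev q)"
    using letters_eqD[OF 1(2)] letters_eqD[OF 1(3)] letters_eqD[OF lt]
    unfolding pc by (simp add: add.assoc)
  then have "len (r + (s + (t + (s + r)))) \<le> length (q @ p @ letters u' @ rev p @ rev q)"
    by (metis len_wd)
  then show "len (r + (s + (t + (s + r)))) < len t" using lt by (simp add: len_def)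
qed

text \<open>All edges separating the identity from the edge of \<open>t\<close> lie on one path of
  the tree. In words: \<open>q @ [a]\<close> and \<open>q' @ [a']\<close> are prefixes of the same
  list, and the shorter one comes first.\<close>

lemma pre_comparable:
  assumes "pre r t" "pre s t" shows "r = s \<or> pre r s \<or> pre s r"
proof -
  have ordered: "r = s \<or> pre r s"
    if "reflection s" "letters r = q @ [a] @ rev q" "letters s = q' @ [a'] @ rev q'"
      "letters t = q @ [a] @ x" "letters t = q' @ [a'] @ x'" "length q \<le> length q'"
    for r s q a x q' a' x'
  proof (cases "length q = length q'")
    case True
    have "q @ [a] @ x = q' @ [a'] @ x'" using that(4)[symmetric] that(5) by (rule HOL.trans)
    with True have "q = q' \<and> a = a'" by simp
    then have "letters r = letters s" using that(2,3) by simp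
    then show ?thesis by (simp add: letters_inject)
  next
    case False
    with that have le: "length (q @ [a]) \<le> length q'" by simp
    have "take (length (q @ [a])) q' = q @ [a]"
      using arg_cong[OF HOL.trans[OF that(4)[symmetric] that(5)], of "take (length (q @ [a]))"] le by simp
    then obtain p where p: "q' = q @ [a] @ p"
      using append_take_drop_id[of "length (q @ [a])" q'] by (metis append.assoc)
    have ls: "letters s = q @ [a] @ (p @ [a'] @ rev p) @ [a] @ rev q" using that p by simp
    from reflection_insideE[OF that(1) ls] show ?thesis
      using that(2) ls unfolding pre_def by fastforce
  qed
  obtain q a u where 1: "letters r = q @ [a] @ rev q"
    "letters t = q @ [a] @ letters u @ [a] @ rev q" using assms(1) by (auto simp: pre_def)
  obtain q' a' u' where 2: "letters s = q' @ [a'] @ rev q'"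
    "letters t = q' @ [a'] @ letters u' @ [a'] @ rev q'" using assms(2) by (auto simp: pre_def)
  show ?thesis
    using ordered[OF pre_reflection(1)[OF assms(2)] 1(1) 2(1) 1(2) 2(2)]
      ordered[OF pre_reflection(1)[OF assms(1)] 2(1) 1(1) 2(2) 1(2)] nat_le_linear by blast
qed

section \<open>Parities of letters\<close>

definition par :: "cox \<Rightarrow> nat \<Rightarrow> bool" where
  "par t k = odd (count_list (letters t) k)"

lemma odd_count_list_push:
  "odd (count_list (push x l) k) = (odd (count_list l k) \<noteq> (x = k))"
  by (auto simp: push_def split: list.splits)

text \<open>Each parity is a homomorphism to Z/2, hence invariant under conjugation: Hurwitz moves
  merely permute the parities of the entries, so entries with distinct parities stay
  distinct.\<close>

lemma par_add: "par (s + t) k = (par s k \<noteq> par t k)"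
proof -
  have "odd (count_list (foldr push u v) k) = (odd (count_list u k) \<noteq> odd (count_list v k))" for u v
    by (induction u) (auto simp: odd_count_list_push)
  then show ?thesis by (simp add: par_def plus_cox.rep_eq)
qed

lemma par_gen: "par (gen j) k = (j = k)"
  by (simp add: par_def gen.rep_eq)

section \<open>The planar order\<close>

text \<open>The natural numbers rotated to start at \<open>x\<close>: first x, x+1, and so on, then
  0 up to x-1. This is how the contour meets edges and corner at a vertex entered through the edge
  with code \<open>x\<close>.\<close>

definition before :: "nat \<Rightarrow> nat \<Rightarrow> nat \<Rightarrow> bool" where
  "before x y z \<longleftrightarrow> (y < x \<longleftrightarrow> z < x) \<and> y < z \<or> x \<le> y \<and> z < x"

text \<open>Embed the Cayley tree in the plane with the edges at every vertex in the cyclic order of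
  their labels, and attach to each vertex a corner between the last and the first edge (code 0).
  The order of these corners along the contour of the tree is lexicographic; the first argument
  is the code of the edge leading to the current vertex.\<close>
fun lts :: "nat \<Rightarrow> nat list \<Rightarrow> nat list \<Rightarrow> bool" where
  "lts x [] [] = False"
| "lts x [] (b # v) = before x 0 (Suc b)"
| "lts x (a # u) [] = before x (Suc a) 0"
| "lts x (a # u) (b # v) = (if a = b then lts (Suc a) u v else before x (Suc a) (Suc b))"

lemma before_trans: "before x a b \<Longrightarrow> before x b c \<Longrightarrow> before x a c"
  by (auto simp: before_def)

lemma before_irrefl: "\<not> before x a a"
  by (auto simp: before_def)

lemma lts_irrefl: "\<not> lts x u u"
  by (induction u arbitrary: x) auto

lemma lts_trans: "lts x u v \<Longrightarrow> lts x v w \<Longrightarrow> lts x u w"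
proof (induction x u v arbitrary: w rule: lts.induct)
  case (2 x b v)
  then show ?case by (cases w) (auto split: if_splits intro: before_trans simp: before_irrefl dest: before_trans)
next
  case (3 x a u)
  then show ?case by (cases w) (auto split: if_splits intro: before_trans simp: before_irrefl dest: before_trans)
next
  case (4 x a u b v)
  then show ?case
    by (cases w) (auto split: if_splits intro: before_trans simp: before_irrefl dest: before_trans)
qed auto

definition lt :: "cox \<Rightarrow> cox \<Rightarrow> bool" where "lt s t = lts 0 (letters s) (letters t)"

lemma lt_irrefl: "\<not> lt s s" by (simp add: lt_def lts_irrefl)
lemma lt_trans: "lt r s \<Longrightarrow> lt s t \<Longrightarrow> lt r t" unfolding lt_def by (rule lts_trans)

section \<open>The cyclic order of the contour and its invariance under left translation\<close>

definition cyc :: "('a \<Rightarrow> 'a \<Rightarrow> bool) \<Rightarrow> 'a \<Rightarrow> 'a \<Rightarrow> 'a \<Rightarrow> bool" where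
  "cyc R u v w \<longleftrightarrow> R u v \<and> R v w \<or> R v w \<and> R w u \<or> R w u \<and> R u v"

definition code :: "nat list \<Rightarrow> nat" where "code l = (case l of [] \<Rightarrow> 0 | a # _ \<Rightarrow> Suc a)"

lemma code_simps [simp]: "code [] = 0" "code (a # l) = Suc a" by (simp_all add: code_def)

text \<open>Entering through edge \<open>k\<close> only rotates the order seen from the root: the
  words with first code above \<open>Suc k\<close> move in front of those below.\<close>

lemma lts_Suc:
  assumes "code u \<noteq> Suc k" "code v \<noteq> Suc k"
  shows "lts (Suc k) u v = (if (code u < Suc k) = (code v < Suc k) then lts 0 u v else code v < Suc k)"
  using assms by (cases u; cases v) (auto simp: before_def)

lemma lts_Cons_left: "code v \<noteq> Suc k \<Longrightarrow> lts 0 (k # u) v = (Suc k < code v)"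
  by (cases v) (auto simp: before_def)

lemma lts_Cons_right: "code v \<noteq> Suc k \<Longrightarrow> lts 0 v (k # u) = (code v < Suc k)"
  by (cases v) (auto simp: before_def)

text \<open>Left multiplication by a generator moves the root across one edge, which rotates the
  linear order and so keeps the cyclic one. The eight cases record which of the three words start
  with \<open>k\<close> and lose this letter; the others gain it.\<close>

lemma cyc_push:
  assumes "distinct_adj u" "distinct_adj v" "distinct_adj w" "cyc (lts 0) u v w"
  shows "cyc (lts 0) (push k u) (push k v) (push k w)"
proof -
  have split: "(\<exists>l'. l = k # l' \<and> push k l = l' \<and> code l' \<noteq> Suc k)
    \<or> (code l \<noteq> Suc k \<and> push k l = k # l)" if "distinct_adj l" for l
    using that by (cases l) (auto simp: push_def code_def split: list.splits)
  have sides: "lts 0 l l' \<and> \<not> lts 0 l' l" if "code l < Suc k" "\<not> code l' < Suc k" for l l'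
    using that by (cases l; cases l') (auto simp: before_def)
  note R = cyc_def lts_Cons_left lts_Cons_right lts_Suc
  show ?thesis
    using split[OF assms(1)] split[OF assms(2)] split[OF assms(3)] assms(4)
    apply (elim disjE exE conjE)
    subgoal using sides by (auto simp: R split: if_splits)
    subgoal using sides by (auto simp: R split: if_splits)
    subgoal using sides by (auto simp: R split: if_splits)
    subgoal using sides by (auto simp: R split: if_splits)
    subgoal using sides by (auto simp: R split: if_splits)
    subgoal using sides by (auto simp: R split: if_splits)
    subgoal using sides by (auto simp: R split: if_splits)
    subgoal using sides by (auto simp: R split: if_splits)
    done
qed

lemma cyc_wd: "cyc lt u v w \<Longrightarrow> cyc lt (wd p + u) (wd p + v) (wd p + w)"
proof (induction p)
  case (Cons k p)
  have "cyc lt r s t \<Longrightarrow> cyc lt (gen k + r) (gen k + s) (gen k + t)" for r s t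
    using cyc_push[of "letters r" "letters s" "letters t" k]
    by (simp add: cyc_def lt_def plus_cox.rep_eq gen.rep_eq)
  from this[OF Cons.IH[OF Cons.prems]] show ?case by (simp add: add.assoc)
qed simp

lemma cyc_add: "cyc lt u v w \<Longrightarrow> cyc lt (g + u) (g + v) (g + w)"
  using cyc_wd[of u v w "letters g"] by simp

text \<open>The words starting with \<open>a\<close> form an interval of the linear order, so they
  cannot alternate cyclically with words outside it.\<close>

lemma cyc_alternating:
  assumes "cyc lt r s t" "cyc lt t u r" "code (letters r) = Suc a" "code (letters t) = Suc a"
    "code (letters s) \<noteq> Suc a" "code (letters u) \<noteq> Suc a"
  shows False
proof -
  obtain r' t' where "letters r = a # r'" "letters t = a # t'"
    using assms(3,4) by (auto simp: code_def split: list.splits)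
  then have "\<not> (lt r s \<and> lt s t)" "\<not> (lt t u \<and> lt u r)"
    using assms(5,6) by (auto simp: lt_def lts_Cons_left lts_Cons_right)
  then have "lt t r" "lt r t" using assms(1,2) by (auto simp: cyc_def)
  then show False using lt_irrefl lt_trans by blast
qed

text \<open>If the middle edge separated the identity from both neighbouring edges, then after a
  translation \<open>x0\<close> and \<open>x2\<close> would lie on one side of an edge and
  \<open>x1\<close> and \<open>x3\<close> on the other, contrary to the cyclic order of the
  four.\<close>

lemma not_pre_both:
  assumes "cyc lt x0 x1 x2" "cyc lt x2 x3 x0"
    and "pre (- x1 + x2) (- x0 + x1)" "pre (- x1 + x2) (- x2 + x3)"
  shows False
proof -
  define t1 t2 t3 where "t1 = - x0 + x1" and "t2 = - x1 + x2" and "t3 = - x2 + x3"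
  note t_defs = t1_def t2_def t3_def
  obtain q a u where 1: "reflection u" "letters t2 = q @ [a] @ rev q"
    "letters t1 = q @ [a] @ letters u @ [a] @ rev q" using assms(3) by (auto simp: pre_def t_defs)
  obtain q' a' u' where 2: "reflection u'" "letters t2 = q' @ [a'] @ rev q'"
    "letters t3 = q' @ [a'] @ letters u' @ [a'] @ rev q'" using assms(4) by (auto simp: pre_def t_defs)
  have q': "q' = q" "a' = a" using palindrome_inject 1(2) 2(2) by metis+
  have refl1: "- t1 = t1"
    using pre_reflection(2)[OF assms(3)] reflection_uminus unfolding t_defs by blast
  \<comment> \<open>Translation by \<open>g\<close> sends \<open>x0\<close>, \<open>x1\<close>,
    \<open>x2\<close>, \<open>x3\<close> to the reduced words
    \<open>[a] @ letters u @ [a] @ rev q\<close>, \<open>rev q\<close>, \<open>[a] @ rev q\<close>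
    and \<open>letters u' @ [a] @ rev q\<close>; only the first and third start with
    \<open>a\<close>.\<close>
  define g where "g = wd (rev q) - x1"
  have d1: "distinct_adj (q @ [a] @ letters u @ [a] @ rev q)"
    using distinct_adj_letters[of t1] unfolding 1(3) .
  have d3: "distinct_adj (q @ [a] @ letters u' @ [a] @ rev q)"
    using distinct_adj_letters[of t3] unfolding 2(3) q' .
  have ne: "letters u' \<noteq> []" using 2(1) by (auto simp: reflection_def)
  have "g + x0 = wd (rev q) + - t1" by (simp add: g_def t_defs minus_add add.assoc diff_conv_add_uminus
      del: add_uminus_conv_diff)
  also have "\<dots> = wd ([a] @ letters u @ [a] @ rev q)"
    by (simp only: refl1) (simp add: letters_eqD[OF 1(3)] add.assoc)
  finally have c0: "code (letters (g + x0)) = Suc a"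
    using letters_wd[OF distinct_adj_appendD2[OF d1]] by simp
  have dq: "distinct_adj (q @ [a])" using d1 by (auto simp: distinct_adj_append_iff)
  moreover from this have "letters (wd (rev q)) = rev q"
    by (intro letters_wd) (auto simp: distinct_adj_append_iff)
  moreover have "g + x1 = wd (rev q)" by (simp add: g_def)
  ultimately have c1: "code (letters (g + x1)) \<noteq> Suc a"
    by (cases q rule: rev_cases) (auto simp: distinct_adj_append_iff)
  have "g + x2 = wd (rev q) + t2" by (simp add: g_def t_defs minus_add add.assoc diff_conv_add_uminus
      del: add_uminus_conv_diff)
  also have "\<dots> = wd ([a] @ rev q)"
    unfolding letters_eqD[OF 1(2)] by (simp add: add.assoc)
  finally have c2: "code (letters (g + x2)) = Suc a"
    using letters_wd[of "[a] @ rev q"] dq by (simp add: distinct_adj_Cons_rev)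
  have "g + x3 = wd (rev q) + t2 + t3" by (simp add: g_def t_defs minus_add add.assoc diff_conv_add_uminus
      del: add_uminus_conv_diff)
  also have "\<dots> = wd (letters u' @ [a] @ rev q)"
    unfolding letters_eqD[OF 1(2)] letters_eqD[OF 2(3)] q' by (simp add: add.assoc)
  finally have "letters (g + x3) = letters u' @ [a] @ rev q"
    using letters_wd[OF distinct_adj_appendD2[OF distinct_adj_appendD2[OF d3]]] by simp
  then have c3: "code (letters (g + x3)) \<noteq> Suc a"
    using d3 ne by (cases "letters u'") (auto simp: distinct_adj_append_iff)
  show False
    using cyc_alternating[OF cyc_add[OF assms(1), of g] cyc_add[OF assms(2), of g] c0 c2 c1 c3] .
qed

section \<open>Braid words\<close>

abbreviation lok :: "nat \<Rightarrow> letter \<Rightarrow> bool" where "lok n l \<equiv> fst l \<in> {1..n-1}"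

definition linv :: "letter \<Rightarrow> letter" where "linv l = (fst l, \<not> snd l)"

lemma linv_simps [simp]: "linv (i, e) = (i, \<not> e)" "fst (linv l) = fst l" "linv (linv l) = l"
  by (simp_all add: linv_def)

lemma BW_simps [simp]: "[] \<in> BW n" "l # w \<in> BW n \<longleftrightarrow> lok n l \<and> w \<in> BW n"
  "u @ w \<in> BW n \<longleftrightarrow> u \<in> BW n \<and> w \<in> BW n"
  by (auto simp: BW_def)

lemma braid_eq_append: "braid_eq n u u' \<Longrightarrow> braid_eq n v v' \<Longrightarrow> braid_eq n (u @ v) (u' @ v')"
  using braid_eq.ctx[of n u u' "[]" v] braid_eq.ctx[of n v v' u' "[]"]
  by (auto intro: braid_eq.trans)

lemma braid_eq_Cons: "braid_eq n u v \<Longrightarrow> braid_eq n (l # u) (l # v)"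
  using braid_eq.ctx[of n u v "[l]" "[]"] by simp

lemma braid_eq_cancel: "lok n l \<Longrightarrow> braid_eq n (l # linv l # w) w"
  using braid_eq.ctx[OF braid_eq.cancel[of "fst l" n "snd l"], of "[]" w]
  by (cases l) simp

lemma braid_eq_cancel': "lok n l \<Longrightarrow> braid_eq n (linv l # l # w) w"
  using braid_eq_cancel[of "linv l" n w] by simp

lemma braid_eq_cancel_left:
  assumes "lok n l" "braid_eq n (l # u) v" shows "braid_eq n u (linv l # v)"
  using braid_eq.sym[OF braid_eq_cancel'[OF assms(1), of u]] braid_eq_Cons[OF assms(2), of "linv l"]
  by (rule braid_eq.trans)

lemma braid_eq_cancel_right:
  assumes "lok n l" "braid_eq n (u @ [l]) v" shows "braid_eq n u (v @ [linv l])"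
proof -
  have "braid_eq n (u @ l # linv l # []) (u @ [])"
    by (intro braid_eq_append braid_eq_cancel assms braid_eq.refl)
  moreover have "braid_eq n ((u @ [l]) @ [linv l]) (v @ [linv l])"
    by (intro braid_eq_append assms braid_eq.refl)
  ultimately show ?thesis by (auto intro: braid_eq.trans braid_eq.sym)
qed

lemma inv_word_Cons: "inv_word (l # w) = inv_word w @ [linv l]"
  by (cases l) (simp add: inv_word_def)

lemma braid_eq_inv_word: "w \<in> BW n \<Longrightarrow> braid_eq n (w @ inv_word w) []"
proof (induction w)
  case (Cons l w)
  then have "braid_eq n ([l] @ (w @ inv_word w) @ [linv l]) ([l] @ [] @ [linv l])"
    by (intro braid_eq_append braid_eq.refl) auto
  with Cons.prems show ?case
    using braid_eq_cancel[of l n "[]"] by (auto simp: inv_word_Cons intro: braid_eq.trans)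
qed (simp add: inv_word_def braid_eq.refl)

lemma braid_eq_rev: "braid_eq n u v \<Longrightarrow> braid_eq n (rev u) (rev v)"
proof (induction rule: braid_eq.induct)
  case (ctx u v p s)
  then show ?case using braid_eq.ctx[OF ctx.IH, of "rev s" "rev p"] by simp
next
  case (cancel i e)
  then show ?case using braid_eq.cancel[of i n "\<not> e"] by simp
next
  case (comm i j)
  then show ?case using braid_eq.sym[OF braid_eq.comm[of i j n]] by simp
next
  case (braid i)
  then show ?case using braid_eq.braid[of i n] by simp
qed (auto intro: braid_eq.intros)

text \<open>Letterwise inversion differs from group inversion by a reversal, which respects the
  braid relations. This covers the representations in which the generators act as inverse Hurwitz
  moves.\<close>

lemma braid_eq_map_linv:
  assumes "w \<in> BW n" "braid_eq n (map linv w) []" shows "braid_eq n w []"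
proof -
  have "inv_word w = rev (map linv w)" by (auto simp: inv_word_def linv_def)
  then have "braid_eq n (w @ inv_word w) (w @ [])"
    using braid_eq_rev[OF assms(2)] by (intro braid_eq_append braid_eq.refl) simp
  then show ?thesis using braid_eq_inv_word[OF assms(1)]
    by (auto intro: braid_eq.trans braid_eq.sym)
qed

lemma braid_eq_comm_letters:
  assumes "1 \<le> i" "i + 2 \<le> j" "j \<le> n - 1"
  shows "braid_eq n [(i, e), (j, f), (i, \<not> e)] [(j, f)]"
proof -
  have ok: "lok n (i, e)" "lok n (j, f)" for e f using assms by auto
  have 1: "braid_eq n [(i, True), (j, True)] [(j, True), (i, True)]"
    using assms by (rule braid_eq.comm)
  have neg_j: "braid_eq n [(i, e), (j, False)] [(j, False), (i, e)]"
    if "braid_eq n [(i, e), (j, True)] [(j, True), (i, e)]" for e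
  proof -
    have "braid_eq n [(i, e)] ([(j, True), (i, e)] @ [(j, False)])"
      using braid_eq_cancel_right[of "(j, True)" n "[(i, e)]" "[(j, True), (i, e)]"] that ok by simp
    then have "braid_eq n ([(j, True)] @ [(i, e), (j, False)]) [(i, e)]"
      by (simp add: braid_eq.sym)
    then show ?thesis using braid_eq_cancel_left[of "(j, True)" n] ok by simp
  qed
  have "braid_eq n [(j, True)] ([(i, False)] @ [(j, True), (i, True)])"
    using braid_eq_cancel_left[OF _ 1] ok by simp
  then have "braid_eq n ([(i, False), (j, True)] @ [(i, True)]) [(j, True)]"
    by (simp add: braid_eq.sym)
  from braid_eq_cancel_right[OF _ this]
  have 2: "braid_eq n [(i, False), (j, True)] [(j, True), (i, False)]" using ok by simp
  have "braid_eq n [(i, e), (j, f)] [(j, f), (i, e)]"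
    using 1 2 neg_j by (cases e; cases f) auto
  then have "braid_eq n ([(i, e), (j, f)] @ [(i, \<not> e)]) ([(j, f), (i, e)] @ [(i, \<not> e)])"
    by (intro braid_eq_append braid_eq.refl)
  moreover have "braid_eq n ([(j, f)] @ ((i, e) # linv (i, e) # [])) ([(j, f)] @ [])"
    by (intro braid_eq_append braid_eq_cancel ok braid_eq.refl)
  ultimately show ?thesis by (auto intro: braid_eq.trans)
qed

section \<open>Newman's lemma for braid actions\<close>

fun along :: "(letter \<Rightarrow> 's \<Rightarrow> 's) \<Rightarrow> ('s \<Rightarrow> bool) \<Rightarrow> 's \<Rightarrow> word \<Rightarrow> bool" where
  "along mv Q s [] = Q s"
| "along mv Q s (l # w) = (Q s \<and> along mv Q (mv l s) w)"

lemma along_True: "along mv (\<lambda>_. True) s w"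
  by (induction w arbitrary: s) auto

text \<open>Confluence up to braid equality. In \<open>peak\<close> the two descents need not be
  joined by further descents: any path through states below the peak will do, and it may start from
  either side.\<close>

locale braid_descent =
  fixes n :: nat and mv :: "letter \<Rightarrow> 's \<Rightarrow> 's" and valid :: "'s \<Rightarrow> bool"
    and desc :: "'s \<Rightarrow> letter \<Rightarrow> bool" and M :: "'s \<Rightarrow> nat"
  assumes act_braid_eq: "braid_eq n u w \<Longrightarrow> fold mv u s = fold mv w s"
    and valid_act: "valid s \<Longrightarrow> lok n l \<Longrightarrow> valid (mv l s)"
    and desc_or: "valid s \<Longrightarrow> lok n l \<Longrightarrow> desc s l \<or> desc (mv l s) (linv l)"
    and desc_M: "valid s \<Longrightarrow> lok n l \<Longrightarrow> desc s l \<Longrightarrow> M (mv l s) < M s"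
    and peak: "valid s \<Longrightarrow> lok n x \<Longrightarrow> lok n y \<Longrightarrow> desc s x \<Longrightarrow> desc s y \<Longrightarrow> x \<noteq> y \<Longrightarrow>
      \<exists>z \<in> BW n.
        braid_eq n (x # z) [y] \<and> along mv (\<lambda>s'. M s' < M s) (mv x s) z \<or>
        braid_eq n (y # z) [x] \<and> along mv (\<lambda>s'. M s' < M s) (mv y s) z"
begin

fun maxd :: "'s \<Rightarrow> word \<Rightarrow> bool" where
  "maxd s [] = (\<forall>l. lok n l \<longrightarrow> \<not> desc s l)"
| "maxd s (l # p) = (lok n l \<and> desc s l \<and> maxd (mv l s) p)"

lemma maxd_exists: "valid s \<Longrightarrow> \<exists>p. maxd s p"
proof (induction "M s" arbitrary: s rule: less_induct)
  case less
  show ?case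
  proof (cases "\<exists>l. lok n l \<and> desc s l")
    case True
    then obtain l where l: "lok n l" "desc s l" by blast
    then obtain p where "maxd (mv l s) p" using less desc_M valid_act by meson
    then have "maxd s (l # p)" using l by simp
    then show ?thesis ..
  qed (auto intro: exI[of _ "[]"])
qed

text \<open>At each step either the letter or its inverse is a descent, so a maximal descent from
  one end of the step prolongs one from the other. Uniqueness at the visited states, those in
  \<open>Q\<close>, identifies the resulting braids.\<close>

lemma path:
  assumes "\<And>s. valid s \<Longrightarrow> Q s \<Longrightarrow> \<forall>p p'. maxd s p \<longrightarrow> maxd s p' \<longrightarrow> braid_eq n p p'"
  shows "valid s \<Longrightarrow> z \<in> BW n \<Longrightarrow> along mv Q s z \<Longrightarrow> maxd s p \<Longrightarrow> maxd (fold mv z s) p'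
    \<Longrightarrow> braid_eq n p (z @ p')"
proof (induction z arbitrary: s p)
  case Nil
  then show ?case using assms by simp
next
  case (Cons l z)
  then have l: "lok n l" by simp
  have v: "valid (mv l s)" using Cons.prems l valid_act by blast
  then obtain p1 where p1: "maxd (mv l s) p1" using maxd_exists by blast
  have "braid_eq n p1 (z @ p')" using Cons.IH[OF v _ _ p1] Cons.prems by simp
  then have *: "braid_eq n (l # p1) ((l # z) @ p')" by (simp add: braid_eq_Cons)
  have Q1: "Q (mv l s)" using Cons.prems by (cases z) auto
  have undo: "mv (linv l) (mv l s) = s"
    using act_braid_eq[OF braid_eq_cancel[OF l, of "[]"], of s] by simp
  have "braid_eq n p (l # p1)"
    using desc_or[OF Cons.prems(1) l]
  proof
    assume "desc s l"
    then have "maxd s (l # p1)" using p1 l by simp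
    then show ?thesis using assms[OF Cons.prems(1)] Cons.prems by simp
  next
    assume "desc (mv l s) (linv l)"
    then have "maxd (mv l s) (linv l # p)" using Cons.prems(4) l undo by simp
    then have "braid_eq n (linv l # p) p1" using assms[OF v Q1] p1 by blast
    then show ?thesis using braid_eq_cancel_left[of "linv l" n p p1] l by simp
  qed
  then show ?case using * by (rule braid_eq.trans)
qed

text \<open>Induction on \<open>M s\<close>. Descents with different first letters are compared
  through the detour of \<open>peak\<close>; it runs below \<open>s\<close>, so the induction
  hypothesis supplies what \<open>path\<close> requires.\<close>

lemma maxd_unique: "valid s \<Longrightarrow> maxd s p \<Longrightarrow> maxd s p' \<Longrightarrow> braid_eq n p p'"
proof (induction "M s" arbitrary: s p p' rule: less_induct)
  case less
  note IH = less.hyps and v = less.prems(1)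
  have step: "braid_eq n (x # p) (y # p')"
    if "maxd s (x # p)" "maxd s (y # p')" "z \<in> BW n" "braid_eq n (x # z) [y]"
      "along mv (\<lambda>s'. M s' < M s) (mv x s) z" for x y p p' z
  proof -
    have "fold mv z (mv x s) = mv y s" using act_braid_eq[OF that(4), of s] by simp
    then have "braid_eq n p (z @ p')"
      using that v by (intro path[where Q = "\<lambda>s'. M s' < M s" and s = "mv x s"]) (auto intro: IH valid_act)
    then have "braid_eq n (x # p) ((x # z) @ p')" by (simp add: braid_eq_Cons)
    moreover have "braid_eq n ((x # z) @ p') ([y] @ p')"
      using that by (intro braid_eq_append braid_eq.refl)
    ultimately show ?thesis by (auto intro: braid_eq.trans)
  qed
  show ?case
  proof (cases p)
    case Nil
    then show ?thesis using less.prems by (cases p') (auto intro: braid_eq.refl)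
  next
    case p: (Cons x q)
    show ?thesis
    proof (cases p')
      case Nil
      then show ?thesis using less.prems p by (cases x) auto
    next
      case p': (Cons y q')
      have xy: "lok n x" "desc s x" "lok n y" "desc s y" using less.prems p p' by auto
      show ?thesis
      proof (cases "x = y")
        case True
        then have "braid_eq n q q'"
          using less.prems p p' xy by (intro IH[of "mv x s"]) (auto intro: desc_M valid_act)
        then show ?thesis using True p p' by (simp add: braid_eq_Cons)
      next
        case False
        from peak[OF v xy(1,3,2,4) False] show ?thesis
          using step[of x q y q'] step[of y q' x q] less.prems p p' by (blast intro: braid_eq.sym)
      qed
    qed
  qed
qed

text \<open>Without descents at \<open>s\<close> the empty word is a maximal descent, and
  \<open>path\<close> along the loop \<open>w\<close> compares it with itself.\<close>

lemma stabilizer_trivial: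
  assumes "valid s" "maxd s []" "w \<in> BW n" "fold mv w s = s"
  shows "braid_eq n w []"
proof -
  have "braid_eq n [] (w @ [])"
    using assms by (intro path[where Q = "\<lambda>_. True" and s = s]) (auto intro: maxd_unique along_True)
  then show ?thesis by (simp add: braid_eq.sym)
qed

end

section \<open>The Hurwitz action on factorizations into reflections\<close>

text \<open>A factorization is represented by its sequence of partial products, so that a braid generator
  changes only one entry.\<close>
definition dif :: "(nat \<Rightarrow> cox) \<Rightarrow> nat \<Rightarrow> cox" where
  "dif v i = - v (i - 1) + v i"

definition hurw :: "letter \<Rightarrow> (nat \<Rightarrow> cox) \<Rightarrow> nat \<Rightarrow> cox" where
  "hurw l v = (let i = fst l in v(i :=
     if snd l then v (Suc i) - v i + v (i - 1) else v (i - 1) - v i + v (Suc i)))"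

lemmas group_norm = add.assoc minus_add diff_conv_add_uminus

lemma dif_hurw:
  assumes "1 \<le> i"
  shows "dif (hurw (i, True) v) k = (if k = i then dif v i + dif v (Suc i) + - dif v i
      else if k = Suc i then dif v i else dif v k)"
    and "dif (hurw (i, False) v) k = (if k = i then dif v (Suc i)
      else if k = Suc i then - dif v (Suc i) + dif v i + dif v (Suc i) else dif v k)"
  using assms by (auto simp: dif_def hurw_def Let_def group_norm simp del: add_uminus_conv_diff)

lemma hurw_braid_eq: "braid_eq n u w \<Longrightarrow> fold hurw u v = fold hurw w v"
proof (induction arbitrary: v rule: braid_eq.induct)
  case (cancel i e)
  then show ?case
    by (cases e) (auto simp: hurw_def Let_def fun_eq_iff group_norm simp del: add_uminus_conv_diff)
next
  case (comm i j)
  then show ?case by (auto simp: hurw_def Let_def fun_eq_iff)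
next
  case (braid i)
  then show ?case
    by (auto simp: hurw_def Let_def fun_eq_iff group_norm simp del: add_uminus_conv_diff)
qed auto

text \<open>The order condition rules out the peak that has no bypass; the distinct parities keep
  the entries distinct, as \<open>pre_dichotomy\<close> demands.\<close>

definition valid :: "nat \<Rightarrow> (nat \<Rightarrow> cox) \<Rightarrow> bool" where
  "valid n v \<longleftrightarrow> (\<forall>i\<in>{1..n}. reflection (dif v i)) \<and> (\<forall>i<n. lt (v i) (v (Suc i)))
     \<and> inj_on (\<lambda>i. par (dif v i)) {1..n}"

definition desc :: "(nat \<Rightarrow> cox) \<Rightarrow> letter \<Rightarrow> bool" where
  "desc v l = (let i = fst l in
     if snd l then pre (dif v i) (dif v (Suc i)) else pre (dif v (Suc i)) (dif v i))"

definition total_len :: "nat \<Rightarrow> (nat \<Rightarrow> cox) \<Rightarrow> nat" where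
  "total_len n v = (\<Sum>k = 1..n. len (dif v k))"

text \<open>If \<open>- x + y\<close> is an involution, left multiplication by \<open>x - y\<close>
  swaps \<open>x\<close> and \<open>y\<close>. It preserves the cyclic order, so the image of
  \<open>z\<close> falls between them; the second part uses \<open>z - y\<close> likewise. The
  images are the new partial products after a Hurwitz move.\<close>

lemma lt_between:
  assumes "lt x y" "lt y z"
  shows "reflection (- x + y) \<Longrightarrow> lt x (x - y + z) \<and> lt (x - y + z) y"
    and "reflection (- y + z) \<Longrightarrow> lt y (z - y + x) \<and> lt (z - y + x) z"
proof -
  have c: "cyc lt x y z" using assms by (auto simp: cyc_def)
  have asym: "\<not> (lt a b \<and> lt b a)" for a b using lt_trans lt_irrefl by blast
  have sym: "- x + y = - y + x" if "reflection (- x + y)" for x y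
    using reflection_uminus[OF that] by (simp add: minus_add)
  {
    assume "reflection (- x + y)"
    have "x - y + x = y"
      using arg_cong[OF sym[OF \<open>reflection (- x + y)\<close>], of "\<lambda>t. x + t"]
      by (simp add: group_norm del: add_uminus_conv_diff)
    then have "cyc lt y x (x - y + z)" using cyc_add[OF c, of "x - y"] by simp
    then show "lt x (x - y + z) \<and> lt (x - y + z) y" using asym assms unfolding cyc_def by blast
  next
    assume "reflection (- y + z)"
    have "z - y + z = y"
      using arg_cong[OF sym[OF \<open>reflection (- y + z)\<close>], of "\<lambda>t. z + t"]
      by (simp add: group_norm del: add_uminus_conv_diff)
    then have "cyc lt (z - y + x) z y" using cyc_add[OF c, of "z - y"] by simp
    then show "lt y (z - y + x) \<and> lt (z - y + x) z" using asym assms unfolding cyc_def by blast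
  }
qed

lemma par_uminus: "par (- s) k = par s k"
  using par_add[of s "- s" k] by (simp add: par_def zero_cox.rep_eq)

lemma valid_hurw:
  assumes v: "valid n v" and l: "lok n l" shows "valid n (hurw l v)"
proof -
  obtain i e where l_eq: "l = (i, e)" by (cases l)
  with l have i: "1 \<le> i" "Suc i \<le> n" by auto
  have r: "reflection (dif v k)" if "k \<in> {1..n}" for k using v that by (auto simp: valid_def)
  have "reflection (dif (hurw l v) k)" if "k \<in> {1..n}" for k
    using r[OF that] r[of i] r[of "Suc i"] i reflection_conj[of "dif v (Suc i)" "dif v i"]
      reflection_conj[of "dif v i" "- dif v (Suc i)"]
    by (cases e) (auto simp: l_eq dif_hurw)
  moreover have "lt (hurw l v k) (hurw l v (Suc k))" if "k < n" for k
  proof -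
    have lt: "lt (v j) (v (Suc j))" if "j < n" for j using v that by (auto simp: valid_def)
    obtain m where m: "i = Suc m" using i by (cases i) auto
    have "reflection (- v m + v i)" "reflection (- v i + v (Suc i))"
      using r[of i] r[of "Suc i"] i m by (auto simp: dif_def)
    with lt_between[OF lt[of m] lt[of i, unfolded m]] i m
    have 1: "lt (v m) (v m - v i + v (Suc i))" "lt (v m - v i + v (Suc i)) (v i)"
      "lt (v i) (v (Suc i) - v i + v m)" "lt (v (Suc i) - v i + v m) (v (Suc i))"
      by auto
    have 2: "lt (v m) (v i)" "lt (v i) (v (Suc i))" using lt i m by auto
    define x where "x = hurw l v i"
    have h: "hurw l v = v(i := x)" by (auto simp: x_def hurw_def l_eq Let_def)
    have "lt (v m) x" "lt x (v (Suc i))"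
      using lt_trans[OF 2(1) 1(3)] lt_trans[OF 1(2) 2(2)] 1
      by (cases e; simp add: x_def hurw_def Let_def l_eq m)+
    then show ?thesis using lt[OF that] m unfolding h by (cases "k = i"; cases "k = m") auto
  qed
  moreover have "inj_on (\<lambda>k. par (dif (hurw l v) k)) {1..n}"
  proof -
    \<comment> \<open>A move at \<open>i\<close> interchanges the parities at positions
      \<open>i\<close> and \<open>Suc i\<close>.\<close>
    let ?p = "\<lambda>k. if k = i then Suc i else if k = Suc i then i else k"
    have "par (dif (hurw l v) k) = par (dif v (?p k))" for k
      using i by (cases e) (auto simp: l_eq dif_hurw par_add par_uminus fun_eq_iff simp del: add_uminus_conv_diff)
    then have eq: "(\<lambda>k. par (dif (hurw l v) k)) = (\<lambda>k. par (dif v k)) \<circ> ?p"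
      by (simp add: comp_def)
    have p: "inj_on ?p {1..n}" "?p ` {1..n} \<subseteq> {1..n}"
      using i by (auto simp: inj_on_def split: if_splits)
    have "inj_on (\<lambda>k. par (dif v k)) {1..n}" using v by (simp add: valid_def)
    then show ?thesis unfolding eq by (intro comp_inj_on p(1)) (rule inj_on_subset[OF _ p(2)])
  qed
  ultimately show ?thesis by (simp add: valid_def)
qed

lemma total_len_less:
  assumes "S \<subseteq> {1..n}" "\<And>k. k \<notin> S \<Longrightarrow> dif v' k = dif v k"
    "(\<Sum>k\<in>S. len (dif v' k)) < (\<Sum>k\<in>S. len (dif v k))"
  shows "total_len n v' < total_len n v"
proof -
  have "total_len n u = (\<Sum>k\<in>{1..n}-S. len (dif u k)) + (\<Sum>k\<in>S. len (dif u k))" for u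
    unfolding total_len_def using assms(1) by (intro sum.subset_diff) auto
  moreover have "(\<Sum>k\<in>{1..n}-S. len (dif v' k)) = (\<Sum>k\<in>{1..n}-S. len (dif v k))"
    using assms(2) by (intro sum.cong) auto
  ultimately show ?thesis using assms(3) by simp
qed

lemma desc_total_len:
  assumes v: "valid n v" and l: "lok n l" and d: "desc v l"
  shows "total_len n (hurw l v) < total_len n v"
proof -
  obtain i e where l_eq: "l = (i, e)" by (cases l)
  with l have i: "1 \<le> i" "Suc i \<le> n" by auto
  then have "reflection (dif v i)" "reflection (dif v (Suc i))" using v by (auto simp: valid_def)
  then show ?thesis
    using i d
    by (intro total_len_less[where S = "{i, Suc i}"])
      (cases e; auto simp: l_eq dif_hurw desc_def reflection_uminus add.assoc dest: len_pre(2)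
        simp del: add_uminus_conv_diff)+
qed

lemma desc_dichotomy:
  assumes v: "valid n v" and l: "lok n l"
  shows "desc v l \<or> desc (hurw l v) (linv l)"
proof -
  obtain i e where l_eq: "l = (i, e)" by (cases l)
  with l have i: "1 \<le> i" "Suc i \<le> n" by auto
  then have r: "reflection (dif v i)" "reflection (dif v (Suc i))" using v by (auto simp: valid_def)
  have "par (dif v i) \<noteq> par (dif v (Suc i))"
  proof
    assume "par (dif v i) = par (dif v (Suc i))"
    moreover have "inj_on (\<lambda>i. par (dif v i)) {1..n}" using v by (simp add: valid_def)
    ultimately have "i = Suc i" using i by (elim inj_onD) auto
    then show False by simp
  qed
  then have "dif v i \<noteq> dif v (Suc i)" by auto
  then show ?thesis
    using i pre_dichotomy[OF r] pre_dichotomy[OF r(2,1)] r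
    by (cases e) (auto simp: l_eq desc_def dif_hurw reflection_uminus add.assoc simp del: add_uminus_conv_diff)
qed

text \<open>The long ways round the hexagon of the braid relation: one letter followed by a detour
  of four letters equals the other letter.\<close>

lemma braid_eq_hexagon:
  assumes "1 \<le> i" "Suc i \<le> n - 1"
  shows "braid_eq n [(i, True), (Suc i, True), (i, True), (Suc i, False), (i, False)] [(Suc i, True)]"
    and "braid_eq n [(i, False), (Suc i, False), (i, False), (Suc i, True), (i, True)] [(Suc i, False)]"
    and "braid_eq n [(Suc i, False), (i, True), (Suc i, True), (i, True), (Suc i, False)] [(i, True)]"
    and "braid_eq n [(Suc i, False), (i, False), (Suc i, True), (i, True), (Suc i, True)] [(i, True)]"
proof -
  let ?s = "(i, True)" and ?t = "(Suc i, True)" and ?S = "(i, False)" and ?T = "(Suc i, False)"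
  have ok: "lok n ?s" "lok n ?t" using assms by auto
  have br: "braid_eq n [?s, ?t, ?s] [?t, ?s, ?t]" using braid_eq.braid[of i n] assms by simp
  have 1: "braid_eq n [?t] [?s, ?t, ?s, ?T, ?S]"
    using braid_eq_cancel_right[OF ok(1), of "[?t]" "[?s, ?t, ?s, ?T]"]
      braid_eq_cancel_right[OF ok(2), of "[?t, ?s]" "[?s, ?t, ?s]"] braid_eq.sym[OF br] by simp
  then show "braid_eq n [?s, ?t, ?s, ?T, ?S] [?t]" by (rule braid_eq.sym)
  have a: "braid_eq n [?s, ?t] [?t, ?s, ?t, ?S]"
    using braid_eq_cancel_right[OF ok(1), of "[?s, ?t]"] br by fastforce
  have b: "braid_eq n [?s] [?t, ?s, ?t, ?S, ?T]"
    using braid_eq_cancel_right[OF ok(2), of "[?s]"] a by fastforce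
  have c: "braid_eq n [?T, ?s] [?s, ?t, ?S, ?T]"
    using braid_eq_cancel_left[OF ok(2) braid_eq.sym[OF b]] braid_eq.sym by force
  have d: "braid_eq n [?S, ?T, ?s] [?t, ?S, ?T]"
    using braid_eq_cancel_left[OF ok(1) braid_eq.sym[OF c]] braid_eq.sym by force
  have e: "braid_eq n [?T, ?S, ?T, ?s] [?S, ?T]"
    using braid_eq_cancel_left[OF ok(2) braid_eq.sym[OF d]] braid_eq.sym by force
  have "braid_eq n [?S, ?T, ?S] [?T, ?S, ?T]"
    using braid_eq_cancel_right[OF ok(1), of "[?T, ?S, ?T]"] e braid_eq.sym by force
  then have "braid_eq n ([?S, ?T, ?S] @ [?t, ?s]) ([?T, ?S, ?T] @ [?t, ?s])"
    by (intro braid_eq_append braid_eq.refl)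
  moreover have "braid_eq n ([?T, ?S] @ (linv ?t # ?t # [?s])) ([?T, ?S] @ [?s])"
    by (intro braid_eq_append braid_eq_cancel' ok braid_eq.refl)
  moreover have "braid_eq n ([?T] @ (linv ?s # ?s # [])) ([?T] @ [])"
    by (intro braid_eq_append braid_eq_cancel' ok braid_eq.refl)
  ultimately show "braid_eq n [?S, ?T, ?S, ?t, ?s] [?T]"
    by (auto intro: braid_eq.trans)
  have "braid_eq n ([?s, ?t, ?s] @ [?T]) ([?t, ?s, ?t] @ [?T])"
    by (intro braid_eq_append br braid_eq.refl)
  moreover have "braid_eq n ([?t, ?s] @ (?t # linv ?t # [])) ([?t, ?s] @ [])"
    by (intro braid_eq_append braid_eq_cancel ok braid_eq.refl)
  ultimately have "braid_eq n [?s, ?t, ?s, ?T] (?t # [?s])" by (auto intro: braid_eq.trans)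
  from braid_eq_cancel_left[OF ok(2) braid_eq.sym[OF this]]
  show "braid_eq n [?T, ?s, ?t, ?s, ?T] [?s]" by (auto intro: braid_eq.sym)
  have "braid_eq n (?s # [?t, ?s]) [?t, ?s, ?t]" using br by simp
  from braid_eq_cancel_left[OF ok(1) braid_eq.sym[OF braid_eq.sym[OF this]]]
  have f: "braid_eq n (?t # [?s]) [?S, ?t, ?s, ?t]" by simp
  from braid_eq.sym[OF braid_eq_cancel_left[OF ok(2) f]]
  show "braid_eq n [?T, ?S, ?t, ?s, ?t] [?s]" by simp
qed

lemma hurw_peak_adjacent:
  assumes v: "valid n v" and i: "1 \<le> i" "Suc i \<le> n - 1"
    and d: "desc v (i, e)" "desc v (Suc i, f)"
  shows "\<exists>z \<in> BW n.
    braid_eq n ((i, e) # z) [(Suc i, f)] \<and>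
      along hurw (\<lambda>v'. total_len n v' < total_len n v) (hurw (i, e) v) z \<or>
    braid_eq n ((Suc i, f) # z) [(i, e)] \<and>
      along hurw (\<lambda>v'. total_len n v' < total_len n v) (hurw (Suc i, f) v) z"
proof -
  define t1 t2 t3 where "t1 = dif v i" and "t2 = dif v (Suc i)" and "t3 = dif v (Suc (Suc i))"
  note t = t1_def[symmetric] t2_def[symmetric] t3_def[symmetric]
  have r: "reflection t1" "reflection t2" "reflection t3"
    using v i by (auto simp: valid_def t1_def t2_def t3_def)
  note inv = r[THEN reflection_uminus] r[THEN reflection_add_self(1)] r[THEN reflection_add_self(2)]
  have below: "total_len n v' < total_len n v"
    if "\<And>k. k \<notin> {i, Suc i, Suc (Suc i)} \<Longrightarrow> dif v' k = dif v k"
      "len (dif v' i) + len (dif v' (Suc i)) + len (dif v' (Suc (Suc i))) < len t1 + len t2 + len t3" for v'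
    using that i by (intro total_len_less[where S = "{i, Suc i, Suc (Suc i)}"]) (auto simp: t)
  have i': "1 \<le> Suc i" by simp
  have ok: "lok n (i, b)" "lok n (Suc i, b)" for b using i by auto
  note hx = braid_eq_hexagon[OF i]
  note S = dif_hurw[OF i(1)] dif_hurw[OF i'] t inv add.assoc minus_add
  note D = d[unfolded desc_def Let_def fst_conv snd_conv]
  \<comment> \<open>The names describe the nesting: \<open>t1\<close> before \<open>t2\<close>
    before \<open>t3\<close>, the reverse, \<open>t1\<close> and \<open>t3\<close> both before
    \<open>t2\<close>, or \<open>t2\<close> before both.\<close>
  consider (up) "e" "f" | (down) "\<not> e" "\<not> f" | (inward) "e" "\<not> f" | (outward) "\<not> e" "f" by blast
  then show ?thesis
  proof cases
    case up
    then have p: "pre t1 t2" "pre t2 t3" using D by (simp_all add: t)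
    note b = len_pre[OF p(1)] len_pre[OF p(2)] pre_chain(2)[OF p] len_pre[OF pre_chain(1)[OF p]]
    have "along hurw (\<lambda>v'. total_len n v' < total_len n v) (hurw (i, True) v)
      [(Suc i, True), (i, True), (Suc i, False), (i, False)]"
      using b by (simp only: along.simps, intro conjI below) (simp_all add: S del: add_uminus_conv_diff)
    then show ?thesis
      using hx(1) up ok
      by (intro bexI[of _ "[(Suc i, True), (i, True), (Suc i, False), (i, False)]"] disjI1) simp_all
  next
    case down
    then have p: "pre t3 t2" "pre t2 t1" using D by (simp_all add: t)
    note b = len_pre[OF p(1)] len_pre[OF p(2)] pre_chain(2)[OF p] len_pre[OF pre_chain(1)[OF p]]
    have "along hurw (\<lambda>v'. total_len n v' < total_len n v) (hurw (i, False) v)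
      [(Suc i, False), (i, False), (Suc i, True), (i, True)]"
      using b by (simp only: along.simps, intro conjI below) (simp_all add: S del: add_uminus_conv_diff)
    then show ?thesis
      using hx(2) down ok
      by (intro bexI[of _ "[(Suc i, False), (i, False), (Suc i, True), (i, True)]"] disjI1) simp_all
  next
    case inward
    then have p: "pre t1 t2" "pre t3 t2" using D by (simp_all add: t)
    have "par t1 \<noteq> par t3"
    proof
      assume "par t1 = par t3"
      moreover have "inj_on (\<lambda>i. par (dif v i)) {1..n}" using v by (simp add: valid_def)
      ultimately have "i = Suc (Suc i)" using i by (elim inj_onD) (auto simp: t)
      then show False by simp
    qed
    \<comment> \<open>Which of the two outer edges is nearer to the identity decides which detour
      stays below the peak.\<close>
    then consider "pre t1 t3" | "pre t3 t1" using pre_comparable[OF p] by auto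
    then show ?thesis
    proof cases
      case 1
      note b = len_pre[OF p(1)] len_pre[OF p(2)] len_pre[OF 1] pre_chain(2)[OF 1 p(2)]
      have "along hurw (\<lambda>v'. total_len n v' < total_len n v) (hurw (Suc i, False) v)
        [(i, True), (Suc i, True), (i, True), (Suc i, False)]"
        using b by (simp only: along.simps, intro conjI below) (simp_all add: S del: add_uminus_conv_diff)
      then show ?thesis
        using hx(3) inward ok
        by (intro bexI[of _ "[(i, True), (Suc i, True), (i, True), (Suc i, False)]"] disjI2) simp_all
    next
      case 2
      note b = len_pre[OF p(1)] len_pre[OF p(2)] len_pre[OF 2] pre_chain(2)[OF 2 p(1)]
      have "along hurw (\<lambda>v'. total_len n v' < total_len n v) (hurw (Suc i, False) v)
        [(i, False), (Suc i, True), (i, True), (Suc i, True)]"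
        using b by (simp only: along.simps, intro conjI below) (simp_all add: S del: add_uminus_conv_diff)
      then show ?thesis
        using hx(4) inward ok
        by (intro bexI[of _ "[(i, False), (Suc i, True), (i, True), (Suc i, True)]"] disjI2) simp_all
    qed
  next
    case outward
    obtain m where m: "i = Suc m" using i by (cases i) auto
    have "lt (v k) (v (Suc k))" if "k < n" for k using v that by (auto simp: valid_def)
    then have lt: "lt (v m) (v i)" "lt (v i) (v (Suc i))" "lt (v (Suc i)) (v (Suc (Suc i)))"
      using i m by auto
    then have "cyc lt (v m) (v i) (v (Suc i))" "cyc lt (v (Suc i)) (v (Suc (Suc i))) (v m)"
      using lt_trans[OF lt(1,2)] by (simp_all add: cyc_def)
    from not_pre_both[OF this] have False using D outward by (simp add: dif_def m)
    then show ?thesis ..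
  qed
qed

lemma hurw_peak:
  assumes v: "valid n v" and ok: "lok n x" "lok n y" and d: "desc v x" "desc v y" and ne: "x \<noteq> y"
  shows "\<exists>z \<in> BW n.
    braid_eq n (x # z) [y] \<and> along hurw (\<lambda>v'. total_len n v' < total_len n v) (hurw x v) z \<or>
    braid_eq n (y # z) [x] \<and> along hurw (\<lambda>v'. total_len n v' < total_len n v) (hurw y v) z"
proof -
  have ordered: "\<exists>z \<in> BW n.
    braid_eq n (x # z) [y] \<and> along hurw (\<lambda>v'. total_len n v' < total_len n v) (hurw x v) z \<or>
    braid_eq n (y # z) [x] \<and> along hurw (\<lambda>v'. total_len n v' < total_len n v) (hurw y v) z"
    if "lok n x" "lok n y" "desc v x" "desc v y" "x \<noteq> y" "fst x \<le> fst y" for x y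
  proof -
    obtain i e j f where xy: "x = (i, e)" "y = (j, f)" by (cases x; cases y)
    with that have ij: "1 \<le> i" "j \<le> n - 1" "i \<le> j" by auto
    consider "i = j" | "j = Suc i" | "i + 2 \<le> j" using ij by linarith
    then show ?thesis
    proof cases
      case 1
      then have "f = (\<not> e)" using that xy by auto
      then show ?thesis
        using that not_pre_sym 1 unfolding xy desc_def Let_def by (cases e) auto
    next
      case 2
      then show ?thesis using hurw_peak_adjacent[OF v] that ij unfolding xy by simp
    next
      case 3
      let ?z = "[(j, f), (i, \<not> e)]"
      have beq: "braid_eq n (x # ?z) [y]" using braid_eq_comm_letters[OF ij(1) 3 ij(2)] unfolding xy by simp
      have x: "total_len n (hurw x v) < total_len n v" using desc_total_len[OF v] that by blast
      have y: "total_len n (hurw y v) < total_len n v" using desc_total_len[OF v] that by blast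
      \<comment> \<open>The two moves concern disjoint pairs of entries.\<close>
      have "desc (hurw x v) y"
        using that(4) 3 ij unfolding xy desc_def Let_def
        by (cases e; cases f) (auto simp: dif_hurw)
      then have "total_len n (hurw y (hurw x v)) < total_len n v"
        using desc_total_len[OF valid_hurw[OF v that(1)] that(2)] x by fastforce
      moreover have "hurw (i, \<not> e) (hurw y (hurw x v)) = hurw y v"
        using hurw_braid_eq[OF beq, of v] xy by simp
      ultimately have "along hurw (\<lambda>v'. total_len n v' < total_len n v) (hurw x v) ?z"
        using x y xy by simp
      moreover have "?z \<in> BW n" using that unfolding xy by auto
      ultimately show ?thesis using beq by blast
    qed
  qed
  show ?thesis
  proof (cases "fst x \<le> fst y")
    case True
    then show ?thesis using ordered[OF ok d ne] by blast
  next
    case False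
    then show ?thesis using ordered[of y x] ok d ne by auto
  qed
qed

text \<open>The letters decrease so that the partial products increase in the planar order.\<close>
definition base :: "nat \<Rightarrow> nat \<Rightarrow> cox" where
  "base n j = wd (map (\<lambda>i. n - i) [1..<Suc (min j n)])"

lemma dif_base: "i \<in> {1..n} \<Longrightarrow> dif (base n) i = gen (n - i)"
proof -
  assume i: "i \<in> {1..n}"
  then obtain m where m: "i = Suc m" by (cases i) auto
  have "base n i = base n m + gen (n - i)" using i by (simp add: base_def m)
  then show ?thesis by (simp add: dif_def m)
qed

text \<open>At the vertex entered through the last letter of \<open>xs\<close>, the rotated order
  meets the corner 0 before any edge with a smaller label.\<close>

lemma lts_increasing:
  "xs \<noteq> [] \<Longrightarrow> last xs > b \<Longrightarrow> lts x xs (xs @ [b])"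
  by (induction xs arbitrary: x) (auto simp: before_def split: if_splits)

lemma valid_base: "valid n (base n)"
proof -
  have "lt (base n i) (base n (Suc i))" if "i < n" for i
  proof -
    let ?l = "\<lambda>i. map (\<lambda>i. n - i) [1..<Suc i]"
    have l: "letters (base n j) = ?l j" if "j \<le> n" for j
    proof -
      have "distinct_adj (?l j)" using that by (auto simp: distinct_adj_conv_nth simp del: upt_Suc)
      then show ?thesis using that by (simp add: base_def letters_wd del: upt_Suc)
    qed
    have "lts 0 (?l i) (?l i @ [n - Suc i])"
    proof (cases i)
      case 0
      then show ?thesis by (simp add: before_def)
    next
      case (Suc m)
      then show ?thesis using that by (intro lts_increasing) auto
    qed
    then show ?thesis using l[of i] l[of "Suc i"] that by (simp add: lt_def)
  qed
  moreover have "inj_on (\<lambda>i. par (dif (base n) i)) {1..n}"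
  proof (rule inj_onI)
    fix i j assume ij: "i \<in> {1..n}" "j \<in> {1..n}" "par (dif (base n) i) = par (dif (base n) j)"
    then have "par (gen (n - i)) (n - i) = par (gen (n - j)) (n - i)" by (simp add: dif_base)
    then show "i = j" using ij by (auto simp: par_gen)
  qed
  ultimately show ?thesis by (auto simp: valid_def dif_base reflection_gen)
qed

interpretation hurwitz: braid_descent n hurw "valid n" desc "total_len n" for n
  by standard (use hurw_braid_eq valid_hurw desc_dichotomy desc_total_len hurw_peak in blast)+

lemma hurwitz_free:
  assumes "w \<in> BW n" "fold hurw w (base n) = base n"
  shows "braid_eq n w []"
proof (rule hurwitz.stabilizer_trivial[OF valid_base _ assms])
  \<comment> \<open>A one-letter word has no room for a nested edge, so \<open>base n\<close> admits
    no descent.\<close>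
  have "\<not> pre (gen i) (gen j)" for i j
    by (auto simp: pre_def gen.rep_eq)
  then show "hurwitz.maxd n (base n) []" by (auto simp: desc_def Let_def dif_base)
qed

section \<open>Evaluating words in a group\<close>

definition ev :: "(nat \<Rightarrow> 'g::group_add) \<Rightarrow> word \<Rightarrow> 'g" where
  "ev g w = sum_list (map (\<lambda>(k, e). if e then g k else - g k) w)"

lemma ev_simps [simp]: "ev g [] = 0" "ev g ((k, e) # w) = (if e then g k else - g k) + ev g w"
  "ev g (u @ w) = ev g u + ev g w"
  by (simp_all add: ev_def)

lemma ev_red: "ev g (red w) = ev g w"
proof (induction w)
  case (Cons x w)
  show ?case
  proof (cases "red w")
    case (Cons y ys)
    then have "ev g w = ev g (y # ys)" using Cons.IH by simp
    then show ?thesis using Cons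
      by (cases x; cases y) (auto simp: cancels_def)
  qed (use Cons.IH in \<open>cases x; simp\<close>)
qed simp

lemma ev_inv_word: "ev g (inv_word w) = - ev g w"
  by (induction w) (auto simp: inv_word_Cons linv_def minus_add, auto simp: inv_word_def)

text \<open>Endomorphisms of the free group thus act on assignments \<open>g\<close> by
  precomposition.\<close>

lemma ev_wsubst: "ev g (wsubst f w) = ev (\<lambda>k. ev g (f k)) w"
proof -
  have "ev g (concat (map (\<lambda>(k, e). if e then f k else inv_word (f k)) w)) = ev (\<lambda>k. ev g (f k)) w"
    by (induction w) (auto simp: ev_inv_word)
  then show ?thesis by (simp add: wsubst_def ev_red)
qed

lemma ev_cong: "(\<And>k. k \<in> fst ` set w \<Longrightarrow> g k = h k) \<Longrightarrow> ev g w = ev h w"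
  by (induction w) auto

lemma ev_rev: "ev g (rev w) = - ev (\<lambda>k. - g k) w"
  by (induction w) (auto simp: minus_add)

definition two :: "'g::group_add \<Rightarrow> 'g \<Rightarrow> nat \<Rightarrow> 'g" where
  "two x y k = (if k = 1 then x else if k = 2 then y else 0)"

lemma two_simps [simp]: "two x y 1 = x" "two x y (Suc 0) = x" "two x y 2 = y"
  by (simp_all add: two_def)

lemma ev_two_swapw: "ev (two x y) (swapw w) = ev (two y x) w"
  by (induction w) (auto simp: swapw_def two_def)

lemma ev_two_rev: "ev (two x y) (rev w) = - ev (two (- x) (- y)) w"
proof -
  have "(\<lambda>k. - two x y k) = two (- x) (- y)" by (auto simp: two_def)
  then show ?thesis by (simp add: ev_rev)
qed

lemma swapw_swapw [simp]: "swapw (swapw w) = w"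
  by (induction w) (auto simp: swapw_def)

text \<open>In \<open>pair2\<close> every letter other than 1 counts as the second generator, whereas \<open>two\<close> kills
  all letters other than 1 and 2. The two conventions agree on each side of \<open>inv2\<close>, although the
  left argument is not required to lie in \<open>Fn 2\<close>.\<close>
lemma ev_inv2:
  fixes x y :: "'g::group_add"
  assumes "inv2 (A, B) (A', B')"
  defines "a \<equiv> ev (two x y) A" and "b \<equiv> ev (two x y) B"
    and "a' \<equiv> ev (two x y) A'" and "b' \<equiv> ev (two x y) B'"
  shows "ev (two a b) A' = x" "ev (two a b) B' = y" "ev (two a' b') A = x" "ev (two a' b') B = y"
proof -
  have fn: "A' \<in> Fn 2" "B' \<in> Fn 2"
    and w1: "wsubst (pair2 A B) A' = [(1, True)]" and w2: "wsubst (pair2 A B) B' = [(2, True)]"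
    and w3: "wsubst (pair2 A' B') A = [(1, True)]" and w4: "wsubst (pair2 A' B') B = [(2, True)]"
    using assms(1) by (simp_all add: inv2_def)
  let ?pr = "\<lambda>x y k. if k = 1 then x else y"
  have pr: "(\<lambda>k. ev h (pair2 U V k)) = ?pr (ev h U) (ev h V)" for h :: "nat \<Rightarrow> 'g" and U V
    by (auto simp: pair2_def)
  have fn_pr: "ev (two p q) W = ev (?pr p q) W" if "W \<in> Fn 2" for W and p q :: 'g
  proof (rule ev_cong)
    fix k assume "k \<in> fst ` set W"
    with that have "k \<in> {1..2}" by (auto simp: Fn_def)
    then have "k = 1 \<or> k = 2" by auto
    then show "two p q k = ?pr p q k" by auto
  qed
  have e: "ev (?pr (ev h A) (ev h B)) A' = h 1" "ev (?pr (ev h A) (ev h B)) B' = h 2"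
    "ev (?pr (ev h A') (ev h B')) A = h 1" "ev (?pr (ev h A') (ev h B')) B = h 2"
    for h :: "nat \<Rightarrow> 'g"
    using w1 w2 w3 w4 ev_wsubst[of h "pair2 A B" A'] ev_wsubst[of h "pair2 A B" B']
      ev_wsubst[of h "pair2 A' B'" A] ev_wsubst[of h "pair2 A' B'" B] by (simp_all add: pr)
  \<comment> \<open>Substituting there and back reproduces \<open>A\<close> and \<open>B\<close> up
    to reduction, but \<open>pair2\<close> reads every letter other than 1 as the second generator.
    Hence only \<open>h 1\<close> and \<open>h 2\<close> can influence their values.\<close>
  have collapse: "ev h A = ev (?pr (h 1) (h 2)) A" "ev h B = ev (?pr (h 1) (h 2)) B"
    for h :: "nat \<Rightarrow> 'g"
  proof -
    have "ev h (wsubst (pair2 A B) (wsubst (pair2 A' B') W)) = ev (?pr (h 1) (h 2)) W" for W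
      by (simp add: ev_wsubst pr e[unfolded One_nat_def] cong: if_cong)
    from this[of A, unfolded w3] this[of B, unfolded w4]
    show "ev h A = ev (?pr (h 1) (h 2)) A" "ev h B = ev (?pr (h 1) (h 2)) B"
      by (simp_all add: ev_wsubst pair2_def)
  qed
  have W: "ev (two p q) A = ev (?pr p q) A" "ev (two p q) B = ev (?pr p q) B" for p q :: 'g
    using collapse[of "two p q"] unfolding two_simps .
  show "ev (two a b) A' = x" "ev (two a b) B' = y" "ev (two a' b') A = x" "ev (two a' b') B = y"
    using e[of "two x y"] unfolding fn_pr[OF fn(1)] fn_pr[OF fn(2)] W a_def b_def a'_def b'_def
    by simp_all
qed

section \<open>Roots of reflections\<close>

definition npow :: "nat \<Rightarrow> 'g::group_add \<Rightarrow> 'g" where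
  "npow r g = sum_list (replicate r g)"

lemma npow_simps [simp]: "npow 0 g = 0" "npow (Suc r) g = g + npow r g"
  by (simp_all add: npow_def)

lemma npow_commute: "npow r g + g = g + npow r g"
  by (induction r) (simp_all add: add.assoc)

lemma npow_uminus: "npow r (- g) = - npow r g"
proof (induction r)
  case (Suc r)
  then have "npow (Suc r) (- g) = - (npow r g + g)" by (simp add: minus_add)
  then show ?case by (simp add: npow_commute)
qed simp

lemma npow_conj: "npow r (h + (g + - h)) = h + (npow r g + - h)"
proof (induction r)
  case (Suc r)
  then show ?case by (simp add: group_norm del: add_uminus_conv_diff)
qed simp

definition sg :: "bool \<Rightarrow> 'g::group_add \<Rightarrow> 'g" where
  "sg b g = (if b then g else - g)"

lemma sg_sg [simp]: "sg b (sg b g) = g" by (simp add: sg_def)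

lemma sg_uminus: "sg b (- g) = - sg b g" by (simp add: sg_def)

lemma npow_sg: "npow r (sg b g) = sg b (npow r g)" by (simp add: sg_def npow_uminus)

lemma uminus_eq_self: "t + t = 0 \<Longrightarrow> - t = (t::'g::group_add)"
  by (rule minus_unique)

lemma add_add_self: "t + t = 0 \<Longrightarrow> t + (t + x) = (x::'g::group_add)"
  by (simp add: add.assoc[symmetric])

type_synonym rgrp = "(cox \<times> nat) perm_grp"

definition transl :: "nat \<Rightarrow> cox \<Rightarrow> rgrp" where
  "transl r t = Perm (\<lambda>(v, j). (if j < r then t + v else v, j))"

text \<open>One step up through the r levels, with \<open>t\<close> applied only on returning from
  the top to level 0; r steps therefore apply \<open>t\<close> once on every level. Points at levels
  from r upwards are fixed.\<close>

definition root :: "nat \<Rightarrow> cox \<Rightarrow> rgrp" where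
  "root r t = Perm (\<lambda>(v, j). if Suc j < r then (v, Suc j) else if Suc j = r then (t + v, 0) else (v, j))"

lemma papp_transl: "papp (transl r t) = (\<lambda>(v, j). (if j < r then t + v else v, j))"
  unfolding transl_def
  by (rule Perm_inverse, simp, rule o_bij[where g = "\<lambda>(v, j). (if j < r then - t + v else v, j)"])
    (auto simp: fun_eq_iff add.assoc[symmetric])

lemma papp_root: "papp (root r t) =
  (\<lambda>(v, j). if Suc j < r then (v, Suc j) else if Suc j = r then (t + v, 0) else (v, j))"
  unfolding root_def
  by (rule Perm_inverse, simp, rule o_bij[where g = "\<lambda>(v, j). if j < r \<and> 0 < j then (v, j - 1)
      else if j < r then (- t + v, r - 1) else (v, j)"])
    (auto simp: fun_eq_iff add.assoc[symmetric])

lemma papp_simps: "papp (f + g) x = papp f (papp g x)" "papp 0 x = x"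
  by (simp_all add: plus_perm_grp.rep_eq zero_perm_grp.rep_eq)

lemma perm_eqI: "(\<And>x. papp f x = papp g x) \<Longrightarrow> f = g"
  by (simp add: papp_inject[symmetric] fun_eq_iff)

lemma transl_add: "transl r (s + t) = transl r s + transl r t"
  by (rule perm_eqI) (auto simp: papp_simps papp_transl add.assoc)

lemma transl_uminus: "transl r (- t) = - transl r t"
proof -
  have "transl r 0 = 0" by (rule perm_eqI) (auto simp: papp_simps papp_transl)
  then have "transl r t + transl r (- t) = 0" by (simp add: transl_add[symmetric])
  then show ?thesis by (simp add: minus_unique)
qed

lemma transl_inject: "r \<ge> 1 \<Longrightarrow> transl r s = transl r t \<Longrightarrow> s = t"
proof -
  assume "r \<ge> 1" "transl r s = transl r t"
  then have "papp (transl r s) (0, 0) = papp (transl r t) (0, 0)" "0 < r" by simp_all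
  then show "s = t" by (simp add: papp_transl)
qed

lemma npow_add: "npow (a + b) g = npow a g + npow b g"
  by (induction a) (simp_all add: add.assoc)

lemma npow_root: "npow r (root r t) = transl r t"
proof (rule perm_eqI)
  fix x :: "cox \<times> nat"
  obtain v j where x: "x = (v, j)" by (cases x)
  have climb: "papp (npow m (root r t)) (u, k) = (u, k + m)" if "k + m < r" for m u k
    using that
    by (induction m) (auto simp: papp_simps papp_root)
  have stay: "papp (npow m (root r t)) (u, k) = (u, k)" if "r \<le> k" for m u k
    using that by (induction m) (auto simp: papp_simps papp_root)
  show "papp (npow r (root r t)) x = papp (transl r t) x"
  proof (cases "j < r")
    case True
    \<comment> \<open>Read from the right: climb from level j to the top, wrap around once, and
      climb back to level j.\<close>
    then have r: "r = j + (Suc 0 + (r - 1 - j))" by simp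
    have "papp (npow (j + (Suc 0 + (r - 1 - j))) (root r t)) (v, j) = (t + v, j)"
      using True unfolding npow_add papp_simps
      by (simp add: climb papp_simps papp_root)
    then show ?thesis using True by (simp add: x papp_transl flip: r)
  next
    case False
    then show ?thesis by (simp add: x stay papp_transl)
  qed
qed

section \<open>Orientation\<close>

text \<open>The r-th power squares to the identity; this makes the signs of r-th powers
  invisible.\<close>

definition good :: "nat \<Rightarrow> 'g::group_add \<Rightarrow> bool" where
  "good r g \<longleftrightarrow> npow r g + npow r g = 0"

lemma good_uminus: "good r g \<Longrightarrow> good r (- g)"
  by (metis good_def npow_uminus uminus_eq_self)

lemma good_sg: "good r g \<Longrightarrow> good r (sg b g)"
  by (simp add: sg_def good_uminus)

lemma npow_twist:
  assumes "t + t = 0" shows "npow r (t + g + t) = t + npow r g + t"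
  using npow_conj[of r t g] uminus_eq_self[OF assms] by (simp add: add.assoc del: add_uminus_conv_diff)

lemma good_twist:
  assumes t: "t + t = 0" and g: "good r g" shows "good r (t + g + t)"
  using g unfolding good_def npow_twist[OF t]
  by (simp add: add.assoc add_add_self[OF t] t) (simp add: add.assoc[symmetric] t)

lemma sg_twist: "t + t = 0 \<Longrightarrow> sg b (t + g + t) = t + sg b g + t"
  by (simp add: sg_def minus_add add.assoc uminus_eq_self diff_conv_add_uminus del: add_uminus_conv_diff)

lemma untwist: "t + t = 0 \<Longrightarrow> t + sg b (t + sg b g + t) + t = g"
  by (simp add: sg_twist) (simp add: add.assoc add_add_self)

lemma npow_sg_good: "good r g \<Longrightarrow> npow r (sg b g) = npow r g"
  unfolding npow_sg by (auto simp: sg_def good_def intro: uminus_eq_self)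

text \<open>On r-th powers X, Y this is the Hurwitz move from (X, Y) to (XYX, X), and
  \<open>bwd\<close> is its inverse. The signs \<open>b\<close> and \<open>c\<close> are chosen once
  for all \<open>x\<close> and \<open>y\<close>; they vanish in r-th powers.\<close>

definition fwd :: "nat \<Rightarrow> word \<times> word \<Rightarrow> bool" where
  "fwd r t \<longleftrightarrow> (\<exists>b c. \<forall>x y :: rgrp. good r x \<longrightarrow> good r y \<longrightarrow>
     ev (two x y) (fst t) = npow r x + sg b y + npow r x \<and> ev (two x y) (snd t) = sg c x)"

definition bwd :: "nat \<Rightarrow> word \<times> word \<Rightarrow> bool" where
  "bwd r t \<longleftrightarrow> (\<exists>b c. \<forall>x y :: rgrp. good r x \<longrightarrow> good r y \<longrightarrow>
     ev (two x y) (fst t) = sg c y \<and> ev (two x y) (snd t) = npow r y + sg b x + npow r y)"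

lemma fwd_swapw: "fwd r (swapw B, swapw A) \<longleftrightarrow> bwd r (A, B)"
  unfolding fwd_def bwd_def by (simp add: ev_two_swapw) blast

lemma bwd_swapw: "bwd r (swapw B, swapw A) \<longleftrightarrow> fwd r (A, B)"
  using fwd_swapw[of r "swapw A" "swapw B"] by simp

text \<open>Reading a word backwards amounts to inverting its value at the inverse arguments
  (\<open>ev_two_rev\<close>), and inversion does not change the r-th power of a good
  element.\<close>

lemma fwd_rev: assumes "fwd r (A, B)" shows "fwd r (rev A, rev B)"
proof -
  obtain b c where *: "good r x \<Longrightarrow> good r y \<Longrightarrow>
     ev (two x y) A = npow r x + sg b y + npow r x \<and> ev (two x y) B = sg c x" for x y :: rgrp
    using assms by (auto simp: fwd_def)
  have "ev (two x y) (rev A) = npow r x + sg b y + npow r x \<and> ev (two x y) (rev B) = sg c x"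
    if "good r x" "good r y" for x y :: rgrp
    using *[OF that[THEN good_uminus]] that(1)
    by (simp add: ev_two_rev sg_uminus npow_uminus group_norm good_def uminus_eq_self
        del: add_uminus_conv_diff)
  then show ?thesis unfolding fwd_def by auto
qed

lemma fwd_rev_iff: "fwd r (rev A, rev B) \<longleftrightarrow> fwd r (A, B)"
  using fwd_rev[of r A B] fwd_rev[of r "rev A" "rev B"] by auto

lemma bwd_rev_iff: "bwd r (rev A, rev B) \<longleftrightarrow> bwd r (A, B)"
  using fwd_rev_iff[of r "swapw B" "swapw A"]
  by (simp add: fwd_swapw[symmetric] swapw_def rev_map)

text \<open>What remains of \<open>inv2\<close> after evaluation; unlike \<open>inv2\<close> it is
  visibly symmetric, so that both directions of each equivalence can be read from it.\<close>

definition inv_ev :: "word \<times> word \<Rightarrow> word \<times> word \<Rightarrow> bool" where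
  "inv_ev t t' \<longleftrightarrow> (\<forall>x y :: rgrp.
     ev (two (ev (two x y) (fst t)) (ev (two x y) (snd t))) (fst t') = x \<and>
     ev (two (ev (two x y) (fst t)) (ev (two x y) (snd t))) (snd t') = y \<and>
     ev (two (ev (two x y) (fst t')) (ev (two x y) (snd t'))) (fst t) = x \<and>
     ev (two (ev (two x y) (fst t')) (ev (two x y) (snd t'))) (snd t) = y)"

lemma inv_ev_inv2: "inv2 t t' \<Longrightarrow> inv_ev t t'"
  using ev_inv2 by (cases t; cases t') (fastforce simp: inv_ev_def)

lemma inv_ev_sym: "inv_ev t t' \<Longrightarrow> inv_ev t' t"
  by (auto simp: inv_ev_def)

lemma inv_ev_fwd: assumes "inv_ev t t'" "fwd r t" shows "bwd r t'"
proof -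
  obtain b c where *: "good r x \<Longrightarrow> good r y \<Longrightarrow>
     ev (two x y) (fst t) = npow r x + sg b y + npow r x \<and> ev (two x y) (snd t) = sg c x" for x y :: rgrp
    using assms(2) by (auto simp: fwd_def)
  have "ev (two x y) (fst t') = sg c y \<and> ev (two x y) (snd t') = npow r y + sg b x + npow r y"
    if g: "good r x" "good r y" for x y :: rgrp
  proof -
    have ty: "npow r y + npow r y = 0" using g by (simp add: good_def)
    \<comment> \<open>The values predicted for the inverse. Since \<open>t\<close> maps them back to
      \<open>x\<close> and \<open>y\<close>, \<open>t'\<close> must produce them.\<close>
    define x' y' where "x' = sg c y" and "y' = npow r y + sg b x + npow r y"
    have gx: "good r x'" using g by (simp add: x'_def good_sg)
    have gy: "good r y'" unfolding y'_def using g by (intro good_twist ty good_sg)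
    have n: "npow r x' = npow r y" using g by (simp add: x'_def npow_sg_good)
    have "sg b y' = npow r y + x + npow r y"
      unfolding y'_def by (subst sg_twist[OF ty]) simp
    then have "npow r x' + sg b y' + npow r x' = x"
      unfolding n by (simp add: add.assoc add_add_self[OF ty] ty)
    then have "ev (two x' y') (fst t) = x" "ev (two x' y') (snd t) = y"
      using *[OF gx gy] by (simp_all add: x'_def)
    then show ?thesis using assms(1) unfolding inv_ev_def x'_def y'_def by metis
  qed
  then show ?thesis unfolding bwd_def by blast
qed

lemma inv_ev_bwd: assumes "inv_ev t t'" "bwd r t" shows "fwd r t'"
proof -
  let ?s = "\<lambda>t. (swapw (snd t), swapw (fst t))"
  have "inv_ev (?s t) (?s t')" using assms(1) by (auto simp: inv_ev_def ev_two_swapw)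
  moreover have "fwd r (?s t)" using assms(2) fwd_swapw[of r "snd t" "fst t"] by simp
  ultimately have "bwd r (?s t')" by (rule inv_ev_fwd)
  then show ?thesis using bwd_swapw[of r "snd t'" "fst t'"] by simp
qed

text \<open>Test at roots of two different generators X and Y: the r-th power of the second image
  would be both X and YXY.\<close>

lemma not_fwd_bwd: assumes "r \<ge> 1" "fwd r t" "bwd r t" shows False
proof -
  define x y where "x = root r (gen 0)" and "y = root r (gen 1)"
  have g: "good r x" "good r y"
    by (simp_all add: x_def y_def good_def npow_root transl_add[symmetric])
       (rule perm_eqI; simp add: papp_simps papp_transl split: prod.splits)+
  have ty: "npow r y + npow r y = 0" using g by (simp add: good_def)
  obtain b c where "ev (two x y) (snd t) = sg c x" using assms(2) g by (auto simp: fwd_def)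
  moreover obtain b' where "ev (two x y) (snd t) = npow r y + sg b' x + npow r y"
    using assms(3) g by (auto simp: bwd_def)
  ultimately have "npow r (sg c x) = npow r (npow r y + sg b' x + npow r y)" by simp
  then have "npow r x = npow r y + npow r x + npow r y"
    unfolding npow_twist[OF ty] npow_sg_good[OF g(1)] .
  then have "transl r (gen 0) = transl r (gen 1 + gen 0 + gen 1)"
    by (simp add: x_def y_def npow_root transl_add)
  then have "gen 0 = gen 1 + gen 0 + gen 1" using transl_inject assms(1) by blast
  then have "letters (gen 0) = letters (gen 1 + gen 0 + gen 1)" by simp
  then show False by (simp add: plus_cox.rep_eq gen.rep_eq push_def)
qed

definition oriented :: "nat \<Rightarrow> quad \<Rightarrow> bool" where
  "oriented r q \<longleftrightarrow> (case q of (A, B, C, D) \<Rightarrow>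
     fwd r (A, B) \<and> fwd r (C, D) \<or> bwd r (A, B) \<and> bwd r (C, D))"

text \<open>Inverse and Swap exchange \<open>fwd\<close> and \<open>bwd\<close> in both halves of
  the quadruple, Backward preserves them.\<close>

lemma oriented_quad_step: assumes "quad_step q q'" shows "oriented r q \<longleftrightarrow> oriented r q'"
proof -
  obtain A B C D where q: "q = (A, B, C, D)" by (cases q)
  obtain A' B' C' D' where q': "q' = (A', B', C', D')" by (cases q')
  consider "inv2 (A, B) (A', B')" "inv2 (C, D) (C', D')"
    | "q' = (swapw D, swapw C, swapw B, swapw A)" | "q' = (rev A, rev B, rev C, rev D)"
    using assms unfolding quad_step_def q q' by auto
  then show ?thesis
  proof cases
    case 1
    note i = 1[THEN inv_ev_inv2]
    have "fwd r (A, B) = bwd r (A', B')" "bwd r (A, B) = fwd r (A', B')"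
      "fwd r (C, D) = bwd r (C', D')" "bwd r (C, D) = fwd r (C', D')"
      using i i[THEN inv_ev_sym] inv_ev_fwd inv_ev_bwd by blast+
    then show ?thesis by (auto simp: oriented_def q q')
  next
    case 2
    then show ?thesis by (auto simp: oriented_def q fwd_swapw bwd_swapw)
  next
    case 3
    then show ?thesis by (auto simp: oriented_def q fwd_rev_iff bwd_rev_iff)
  qed
qed

lemma oriented_quad_equiv: "quad_equiv q q' \<Longrightarrow> oriented r q \<longleftrightarrow> oriented r q'"
  unfolding quad_equiv_def
  by (induction rule: equivclp_induct) (auto dest: oriented_quad_step)

lemma ev_replicate: "ev g (replicate r (k, True)) = npow r (g k)"
  "ev g (replicate r (k, False)) = - npow r (g k)"
  by (induction r) (auto simp: minus_add npow_commute[symmetric])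

lemma fwdI:
  assumes "\<And>x y :: rgrp. npow r x + npow r x = 0 \<Longrightarrow> npow r y + npow r y = 0 \<Longrightarrow>
     ev (two x y) A = npow r x + (sg b y + npow r x) \<and> ev (two x y) B = sg c x"
  shows "fwd r (A, B)"
  unfolding fwd_def good_def using assms by (auto simp: add.assoc)

text \<open>The words \<open>replicate r ga\<close> and \<open>replicate r gA\<close> have equal
  values, since the r-th power of the first argument is its own inverse.\<close>

lemma fwd_entries_A:
  "fwd r (replicate r ga @ [gb] @ replicate r gA, [ga])"
  "fwd r (replicate r ga @ [gB] @ replicate r gA, [gA])"
  "fwd r (replicate r gA @ [gB] @ replicate r ga, [gA])"
  by (rule fwdI[where b = True and c = True], simp add: ev_replicate sg_def uminus_eq_self del: add_uminus_conv_diff)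
    (rule fwdI[where b = False and c = False], simp add: ev_replicate sg_def uminus_eq_self del: add_uminus_conv_diff)+

lemma oriented_entries_A: "e \<in> entries_A r \<Longrightarrow> oriented r e"
  using fwd_entries_A[of r] by (auto simp: entries_A_def oriented_def)

text \<open>For r = 1 the arguments themselves are involutions: squares of \<open>b\<close> vanish
  and every sign may be taken positive.\<close>

lemma fwd_entries_CD:
  "fwd 1 ([ga, gB, ga], [ga])" "fwd 1 ([ga, gb, ga], [gA])"
  "fwd 1 ([gA, gB, ga], [gb, gb, ga])" "fwd 1 ([ga, gb, gA], [gb, gb, gA])"
  "fwd 1 ([gA, gb, ga], [gA, gb, gb])"
  by (rule fwdI[where b = True and c = True],
      simp add: sg_def uminus_eq_self add_add_self del: add_uminus_conv_diff)+

lemma oriented_entries_C: "e \<in> entries_C \<Longrightarrow> oriented 1 e"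
  using fwd_entries_CD by (auto simp: entries_C_def oriented_def)

lemma oriented_entries_D: "e \<in> entries_D \<Longrightarrow> oriented 1 e"
  using fwd_entries_CD by (auto simp: entries_D_def oriented_def)

section \<open>Comparing local representations with the Hurwitz action\<close>

text \<open>The invariant linking both actions: the generators of the free group are sent to r-th
  roots of the entries of a valid factorization.\<close>

definition rooted :: "nat \<Rightarrow> nat \<Rightarrow> (nat \<Rightarrow> rgrp) \<Rightarrow> (nat \<Rightarrow> cox) \<Rightarrow> bool" where
  "rooted r n g v \<longleftrightarrow> valid n v \<and> (\<forall>k\<in>{1..n}. npow r (g k) = transl r (dif v k))"

lemma transl_reflection: "reflection t \<Longrightarrow> transl r t + transl r t = 0"
  by (simp add: transl_uminus[symmetric] reflection_uminus eq_neg_iff_add_eq_0[symmetric])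

lemma rooted_good: "rooted r n g v \<Longrightarrow> k \<in> {1..n} \<Longrightarrow> good r (g k)"
  by (auto simp: rooted_def good_def valid_def transl_reflection)

definition up :: "nat \<Rightarrow> nat \<Rightarrow> bool \<Rightarrow> bool \<Rightarrow> (nat \<Rightarrow> rgrp) \<Rightarrow> nat \<Rightarrow> rgrp" where
  "up r i b c g = g(i := npow r (g i) + sg b (g (Suc i)) + npow r (g i), Suc i := sg c (g i))"

definition down :: "nat \<Rightarrow> nat \<Rightarrow> bool \<Rightarrow> bool \<Rightarrow> (nat \<Rightarrow> rgrp) \<Rightarrow> nat \<Rightarrow> rgrp" where
  "down r i b c g = g(i := sg c (g (Suc i)),
     Suc i := npow r (g (Suc i)) + sg b (g i) + npow r (g (Suc i)))"

lemma rooted_up_down: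
  assumes R: "rooted r n g v" and i: "1 \<le> i" "i \<le> n - 1"
  shows "rooted r n (up r i b c g) (hurw (i, True) v)"
    and "rooted r n (down r i b c g) (hurw (i, False) v)"
    and "up r i b c (down r i b c g) = g"
    and "down r i b c (up r i b c g) = g"
proof -
  have k: "i \<in> {1..n}" "Suc i \<in> {1..n}" using i by auto
  have v: "valid n v" using R by (simp add: rooted_def)
  have refl: "reflection (dif v i)" "reflection (dif v (Suc i))" using v k by (auto simp: valid_def)
  note good = R[THEN rooted_good, OF k(1)] R[THEN rooted_good, OF k(2)]
  have inv: "npow r (g i) + npow r (g i) = 0" "npow r (g (Suc i)) + npow r (g (Suc i)) = 0"
    using good by (simp_all add: good_def)
  have n: "npow r (g k) = transl r (dif v k)" if "k \<in> {1..n}" for k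
    using R that by (simp add: rooted_def)
  note S = npow_sg_good[OF good(1)] npow_sg_good[OF good(2)] npow_twist[OF inv(1)] npow_twist[OF inv(2)]
    sg_twist[OF inv(1)] sg_twist[OF inv(2)]
  have "lok n (i, e)" for e using i by simp
  then have v': "valid n (hurw (i, e) v)" for e by (rule valid_hurw[OF v])
  have up: "npow r (up r i b c g k) = (if k = i then npow r (g i) + npow r (g (Suc i)) + npow r (g i)
    else if k = Suc i then npow r (g i) else npow r (g k))" for k
    by (simp add: up_def S)
  have "npow r (up r i b c g k) = transl r (dif (hurw (i, True) v) k)" if "k \<in> {1..n}" for k
    unfolding up using n[OF that] n[OF k(1)] n[OF k(2)] refl
    by (simp add: dif_hurw(1)[OF i(1)] transl_add reflection_uminus del: add_uminus_conv_diff)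
  then show "rooted r n (up r i b c g) (hurw (i, True) v)" using v' by (simp add: rooted_def)
  have down: "npow r (down r i b c g k) = (if k = i then npow r (g (Suc i))
    else if k = Suc i then npow r (g (Suc i)) + npow r (g i) + npow r (g (Suc i)) else npow r (g k))" for k
    by (simp add: down_def S)
  have "npow r (down r i b c g k) = transl r (dif (hurw (i, False) v) k)" if "k \<in> {1..n}" for k
    unfolding down using n[OF that] n[OF k(1)] n[OF k(2)] refl
    by (simp add: dif_hurw(2)[OF i(1)] transl_add reflection_uminus del: add_uminus_conv_diff)
  then show "rooted r n (down r i b c g) (hurw (i, False) v)" using v' by (simp add: rooted_def)
  show "up r i b c (down r i b c g) = g" "down r i b c (up r i b c g) = g"
    by (auto simp: up_def down_def S(1,2) untwist[OF inv(1)] untwist[OF inv(2)] fun_eq_iff)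
qed

lemma ev_Tmap:
  assumes "aut2 t"
  shows "ev g (Tmap i t k) = (if k = i then ev (two (g i) (g (Suc i))) (fst t)
     else if k = Suc i then ev (two (g i) (g (Suc i))) (snd t) else g k)"
proof -
  have let2: "fst ` set (fst t) \<subseteq> {1..2}" "fst ` set (snd t) \<subseteq> {1..2}"
  proof -
    have "\<forall>i\<in>{1..2}. fst ` set (pair2 (fst t) (snd t) i) \<subseteq> {1..2}"
      using assms unfolding aut2_def is_aut_def by (rule conjunct1)
    from bspec[OF this, of 1] bspec[OF this, of 2]
    show "fst ` set (fst t) \<subseteq> {1..2}" "fst ` set (snd t) \<subseteq> {1..2}"
      by (simp_all add: pair2_def)
  qed
  have "ev g (wsubst (pair2 [(i, True)] [(Suc i, True)]) w) = ev (two (g i) (g (Suc i))) w"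
    if "fst ` set w \<subseteq> {1..2}" for w
    unfolding ev_wsubst
  proof (rule ev_cong)
    fix k assume "k \<in> fst ` set w"
    with that have "k \<in> {1..2}" by blast
    then have "k = 1 \<or> k = 2" by auto
    then show "ev g (pair2 [(i, True)] [(Suc i, True)] k) = two (g i) (g (Suc i)) k"
      by (auto simp: pair2_def)
  qed
  with let2 show ?thesis by (simp add: Tmap_def)
qed

text \<open>For a negative letter the new assignment is characterized by mapping back to
  \<open>g\<close>, which avoids the definite description in \<open>act_letter\<close>.\<close>

lemma rooted_letter:
  assumes R: "rooted r n g v" and l: "lok n l" and aut: "aut2 (\<tau> (fst l))"
    and o: "if p then fwd r (\<tau> (fst l)) else bwd r (\<tau> (fst l))"
  shows "\<exists>g'. rooted r n g' (hurw (if p then l else linv l) v) \<and>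
    (if snd l then g' = (\<lambda>k. ev g (Tmap (fst l) (\<tau> (fst l)) k))
     else g = (\<lambda>k. ev g' (Tmap (fst l) (\<tau> (fst l)) k)))"
proof -
  obtain i e where l_eq: "l = (i, e)" by (cases l)
  have i: "1 \<le> i" "i \<le> n - 1" using l by (auto simp: l_eq)
  then have k: "i \<in> {1..n}" "Suc i \<in> {1..n}" by auto
  show ?thesis
  proof (cases p)
    case True
    then obtain b c where *: "\<And>x y :: rgrp. good r x \<Longrightarrow> good r y \<Longrightarrow>
      ev (two x y) (fst (\<tau> i)) = npow r x + sg b y + npow r x \<and> ev (two x y) (snd (\<tau> i)) = sg c x"
      using o by (auto simp: fwd_def l_eq)
    have T: "(\<lambda>k. ev h (Tmap i (\<tau> i) k)) = up r i b c h" if "rooted r n h u" for h u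
      using *[OF rooted_good[OF that k(1)] rooted_good[OF that k(2)]] aut
      by (auto simp: ev_Tmap up_def fun_eq_iff l_eq)
    show ?thesis
    proof (cases e)
      case e: True
      show ?thesis
        using rooted_up_down(1)[OF R i, of b c] T[OF R] True e by (auto simp: l_eq)
    next
      case e: False
      show ?thesis
        using rooted_up_down(2,3)[OF R i, of b c] T[OF rooted_up_down(2)[OF R i, of b c]] True e
        by (auto simp: l_eq intro!: exI[of _ "down r i b c g"])
    qed
  next
    case False
    then obtain b c where *: "\<And>x y :: rgrp. good r x \<Longrightarrow> good r y \<Longrightarrow>
      ev (two x y) (fst (\<tau> i)) = sg c y \<and> ev (two x y) (snd (\<tau> i)) = npow r y + sg b x + npow r y"
      using o by (auto simp: bwd_def l_eq)
    have T: "(\<lambda>k. ev h (Tmap i (\<tau> i) k)) = down r i b c h" if "rooted r n h u" for h u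
      using *[OF rooted_good[OF that k(1)] rooted_good[OF that k(2)]] aut
      by (auto simp: ev_Tmap down_def fun_eq_iff l_eq)
    show ?thesis
    proof (cases e)
      case e: True
      show ?thesis
        using rooted_up_down(2)[OF R i, of b c] T[OF R] False e by (auto simp: l_eq)
    next
      case e: False
      show ?thesis
        using rooted_up_down(1,4)[OF R i, of b c] T[OF rooted_up_down(1)[OF R i, of b c]] False e
        by (auto simp: l_eq intro!: exI[of _ "up r i b c g"])
    qed
  qed
qed

text \<open>The representation acts on the right, while \<open>hurw\<close> acts by precomposition; hence \<open>foldr\<close>.\<close>
lemma rooted_word:
  assumes rep: "local_rep n \<tau>"
    and o: "\<And>i. i \<in> {1..n-1} \<Longrightarrow> if p then fwd r (\<tau> i) else bwd r (\<tau> i)"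
  shows "w \<in> BW n \<Longrightarrow> rooted r n g v \<Longrightarrow>
    \<exists>g'. rooted r n g' (foldr hurw (map (\<lambda>l. if p then l else linv l) w) v)
      \<and> (\<forall>x\<in>Fn n. ev g (act \<tau> n w x) = ev g' x)"
proof (induction w arbitrary: g v rule: rev_induct)
  case Nil
  then show ?case by (auto simp: act_def)
next
  case (snoc l w)
  have l: "lok n l" and w: "w \<in> BW n" using snoc.prems(1) by simp_all
  let ?f = "Tmap (fst l) (\<tau> (fst l))"
  have aut: "aut2 (\<tau> (fst l))" using rep l by (auto simp: local_rep_def)
  obtain g1 where g1: "rooted r n g1 (hurw (if p then l else linv l) v)"
    and g1_eq: "if snd l then g1 = (\<lambda>k. ev g (?f k)) else g = (\<lambda>k. ev g1 (?f k))"
    using rooted_letter[where p = p and \<tau> = \<tau>, OF snoc.prems(2) l aut o[OF l]] by blast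
  obtain g2 where g2: "rooted r n g2 (foldr hurw (map (\<lambda>l. if p then l else linv l) w)
      (hurw (if p then l else linv l) v))" and g2_eq: "\<forall>x\<in>Fn n. ev g1 (act \<tau> n w x) = ev g2 x"
    using snoc.IH[OF w g1] by blast
  have "ev g (act \<tau> n (w @ [l]) x) = ev g1 (act \<tau> n w x)" if x: "x \<in> Fn n" for x
  proof (cases "snd l")
    case True
    then show ?thesis using g1_eq by (simp add: act_def act_letter_def ev_wsubst)
  next
    case False
    let ?y = "act \<tau> n (w @ [l]) x"
    \<comment> \<open>Appending the positive letter \<open>linv l\<close> undoes \<open>l\<close>,
      because the representation respects cancellation; its effect is a plain substitution.\<close>
    have "braid_eq n (w @ l # linv l # []) (w @ [])"
      by (intro braid_eq_append braid_eq_cancel l braid_eq.refl)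
    then have "act \<tau> n (w @ [l, linv l]) x = act \<tau> n w x"
      using rep x l w by (auto simp: local_rep_def)
    moreover have "act \<tau> n (w @ [l, linv l]) x = wsubst ?f ?y"
      using False by (simp add: act_def act_letter_def linv_def)
    ultimately have "ev g1 (act \<tau> n w x) = ev g1 (wsubst ?f ?y)" by simp
    then show ?thesis using g1_eq False by (simp add: ev_wsubst)
  qed
  then show ?case using g2 g2_eq by auto
qed

lemma foldr_hurw_outside: "w \<in> BW n \<Longrightarrow> j \<notin> {1..n-1} \<Longrightarrow> foldr hurw w v j = v j"
  by (induction w) (auto simp: hurw_def Let_def)

lemma faithful_oriented:
  assumes rep: "local_rep n \<tau>" and r: "r \<ge> 1"
    and o: "\<And>i. i \<in> {1..n-1} \<Longrightarrow> if p then fwd r (\<tau> i) else bwd r (\<tau> i)"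
  shows "faithful n \<tau>"
  unfolding faithful_def
proof (intro ballI impI)
  fix w assume w: "w \<in> BW n" and triv: "\<forall>x\<in>Fn n. act \<tau> n w x = x"
  define g where "g k = root r (dif (base n) k)" for k
  define w' where "w' = map (\<lambda>l. if p then l else linv l) w"
  have w': "w' \<in> BW n" using w unfolding w'_def by (induction w) auto
  have "rooted r n g (base n)" by (auto simp: rooted_def valid_base g_def npow_root)
  from rooted_word[where p = p and \<tau> = \<tau>, OF rep o w this] obtain g' where
    g': "rooted r n g' (foldr hurw w' (base n))" "\<forall>x\<in>Fn n. ev g (act \<tau> n w x) = ev g' x"
    unfolding w'_def by blast
  have dif_eq: "dif (foldr hurw w' (base n)) k = dif (base n) k" if k: "k \<in> {1..n}" for k
  proof -
    have "[(k, True)] \<in> Fn n" using k by (auto simp: Fn_def reduced_def)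
    then have "g k = g' k" using g'(2) triv by fastforce
    then have "transl r (dif (base n) k) = transl r (dif (foldr hurw w' (base n)) k)"
      using g'(1) k by (simp add: rooted_def g_def npow_root[symmetric])
    then show ?thesis using transl_inject[OF r] by metis
  qed
  \<comment> \<open>Equal entries give equal partial products, starting from the one at 0, which no
    move alters.\<close>
  have "foldr hurw w' (base n) j = base n j" if "j \<le> n" for j
    using that
  proof (induction j)
    case 0
    then show ?case using foldr_hurw_outside[OF w', of 0] by simp
  next
    case (Suc j)
    then show ?case using dif_eq[of "Suc j"] by (simp add: dif_def)
  qed
  then have "foldr hurw w' (base n) j = base n j" for j
    using foldr_hurw_outside[OF w', of j] by (cases "j \<le> n") auto
  then have "fold hurw (rev w') (base n) = base n"
    by (simp add: foldr_conv_fold[symmetric] fun_eq_iff)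
  moreover have "rev w' \<in> BW n" using w' by (auto simp: BW_def)
  ultimately have "braid_eq n (rev (rev w')) (rev [])" by (intro braid_eq_rev hurwitz_free)
  then have "braid_eq n w' []" by simp
  then show "braid_eq n w []"
    using braid_eq_map_linv[OF w] by (cases p) (simp_all add: w'_def)
qed

lemma fwd_red: "fwd r (red A, red B) = fwd r (A, B)" "bwd r (red A, red B) = bwd r (A, B)"
  by (simp_all add: fwd_def bwd_def ev_red)

theorem theorem2p2:
  fixes n :: nat and \<tau> :: "nat \<Rightarrow> word \<times> word"
  assumes "n \<ge> 3"
    and "local_rep n \<tau>"
    and "(\<exists>r\<ge>1. of_type n \<tau> (entries_A r)) \<or> of_type n \<tau> entries_C \<or> of_type n \<tau> entries_D"
  shows "faithful n \<tau>"
proof -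
  have ori: "oriented r (quad_of \<tau> i)"
    if "of_type n \<tau> L" "\<And>e. e \<in> L \<Longrightarrow> oriented r e" "i \<in> {1..n-2}" for r L i
    using that oriented_quad_equiv[of "quad_of \<tau> i" _ r] unfolding of_type_def by blast
  \<comment> \<open>Types C and D are treated with r = 1.\<close>
  have "\<exists>r\<ge>1. \<forall>i\<in>{1..n-2}. oriented r (quad_of \<tau> i)"
    using assms(3) ori[OF _ oriented_entries_A] ori[OF _ oriented_entries_C]
      ori[OF _ oriented_entries_D] by blast
  then obtain r where r: "r \<ge> 1" and quads: "\<And>i. i \<in> {1..n-2} \<Longrightarrow> oriented r (quad_of \<tau> i)"
    by blast
  have step: "fwd r (\<tau> i) \<and> fwd r (\<tau> (Suc i)) \<or> bwd r (\<tau> i) \<and> bwd r (\<tau> (Suc i))"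
    if "i \<in> {1..n-2}" for i
    using quads[OF that] by (simp add: oriented_def quad_of_def fwd_red)
  define p where "p = fwd r (\<tau> 1)"
  \<comment> \<open>Neighbouring automorphisms share an orientation and none has both, so the
    orientation of the first spreads to all.\<close>
  have "if p then fwd r (\<tau> (Suc i)) else bwd r (\<tau> (Suc i))" if "Suc i \<le> n - 1" for i
    using that
  proof (induction i)
    case 0
    then show ?case using step[of 1] assms(1) by (auto simp: p_def)
  next
    case (Suc i)
    then have "Suc i \<in> {1..n-2}" by auto
    with Suc show ?case using step[of "Suc i"] not_fwd_bwd[OF r, of "\<tau> (Suc i)"] by (auto split: if_splits)
  qed
  then have "if p then fwd r (\<tau> i) else bwd r (\<tau> i)" if "i \<in> {1..n-1}" for i
    using that by (cases i) auto
  then show ?thesis by (rule faithful_oriented[OF assms(2) r])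
qed

end
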